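(* Let $\mathcal{P}_{\mathrm{full}}$ be a full plant behavior and $\mathcal{S}$ a specification. Let the control manifest behavior $\mathcal{P}_{c}$ be the kernel of $P_{c}(\frac{d}{dt})$ and let a controller $\mathcal{C}\in\mathfrak{C}_{\mathrm{can}}^{\mathrm{reg}}$ be the kernel of $C(\frac{d}{dt})$, where the polynomial matrices $P_c$ and $C$ are both of full row rank. Then a controller $\mathcal{C}^{\prime}$ is an element of $\mathfrak{C}_{\mathrm{can}}^{\mathrm{reg}}$ if and only if it is the kernel of $V(\frac{d}{dt})P_{c}(\frac{d}{dt})+C(\frac{d}{dt})$ for some polynomial matrix $V(\xi)$.
   Context: A (linear differential) behavior in $q$ variables is a set of the form $\{x\in\mathfrak{C}^\infty(\mathbb{R},\mathbb{R}^q) : A(\frac{d}{dt})x=0\}$ with $A\in\mathbb{R}^{g\times q}[\xi]$ a real polynomial matrix ($g\ge 0$); it is called the kernel of $A(\frac{d}{dt})$. Here $\mathfrak{C}^\infty$ denotes infinitely differentiable functions. Ranks of polynomial matrices are taken over the field $\mathbb{R}(\xi)$. Every behavior has a kernel representation of full row rank. Full plant behavior: $\mathcal{P}_{\mathrm{full}}=\{(w,c)\in\mathfrak{C}^{\infty}(\mathbb{R},\mathbb{R}^{\mathtt{w}+\mathtt{c}}) : R(\frac{d}{dt})w+M(\frac{d}{dt})c=0\}$, with $R,M$ real polynomial matrices; $w$ are the to-be-controlled variables and $c$ the control variables. A specification is a behavior $\mathcal{S}=\{w\in\mathfrak{C}^{\infty}(\mathbb{R},\mathbb{R}^{\mathtt{w}})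 : S(\frac{d}{dt})w=0\}$, $S$ a polynomial matrix. A controller is a behavior $\mathcal{C}=\{c\in\mathfrak{C}^{\infty}(\mathbb{R},\mathbb{R}^{\mathtt{c}}) : C(\frac{d}{dt})c=0\}$. A controller $\mathcal{C}$, given by a full row rank $C$, is regular if $\operatorname{rank}\begin{bmatrix}R&M\\0&C\end{bmatrix}=\operatorname{rank}\begin{bmatrix}R&M\end{bmatrix}+\operatorname{rank}C$ (this does not depend on the chosen representations). Control manifest behavior: $\mathcal{P}_c=\{c\in\mathfrak{C}^{\infty}(\mathbb{R},\mathbb{R}^{\mathtt{c}}) : \exists\, w\in\mathfrak{C}^{\infty}(\mathbb{R},\mathbb{R}^{\mathtt{w}}),\ (w,c)\in\mathcal{P}_{\mathrm{full}}\}$. Canonical controller: $\mathcal{C}_{\mathrm{can}}=\{c\in\mathfrak{C}^{\infty}(\mathbb{R},\mathbb{R}^{\mathtt{c}}) : \exists\, w\in\mathcal{S},\ (w,c)\in\mathcal{P}_{\mathrm{full}}\}$. Both $\mathcal{P}_c$ and $\mathcal{C}_{\mathrm{can}}$ are linear differential behaviors in $\mathtt{c}$ variables, i.e. each is of the form $\{c\in\mathfrak{C}^{\infty}(\mathbb{R},\mathbb{R}^{\mathtt{c}}) : A(\frac{d}{dt})c=0\}$ for some real polynomial matrix $A$ with $\mathtt{c}$ columns. Finally $\mathfrak{C}_{\mathrm{can}}^{\mathrm{reg}}=\{\mathcal{C} : \mathcal{C}\text{ is a regular controller and }\mathcal{C}\cap\mathcal{P}_c=\mathcal{C}_{\mathrm{can}}\cap\mathcal{P}_c\}$.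 *)

theory Defs
  imports
    "HOL-Analysis.Derivative"
    "HOL-Computational_Algebra.Polynomial_Factorial"
    "Jordan_Normal_Form.DL_Rank"
begin

text \<open>
  The type \<open>vec\<close>, the function \<open>vec\<close> and indexing \<open>$\<close> are those of Jordan_Normal_Form.
  Trajectories with \<open>q\<close> components are functions from the reals to \<open>carrier_vec q\<close>; the number of
  variables of a polynomial matrix is its number of columns. Matrices without rows are allowed.
\<close>

type_synonym traj = "real \<Rightarrow> real vec"

definition smooth_fun :: "(real \<Rightarrow> real) \<Rightarrow> bool" where
  "smooth_fun f \<longleftrightarrow> (\<forall>n t. ((deriv ^^ n) f) differentiable (at t))"

definition smooth_traj :: "nat \<Rightarrow> traj set" where
  "smooth_traj q = {x. (\<forall>t. x t \<in> carrier_vec q) \<and> (\<forall>j<q. smooth_fun (\<lambda>t. x t $ j))}"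

definition poly_diff :: "real poly \<Rightarrow> (real \<Rightarrow> real) \<Rightarrow> real \<Rightarrow> real" where
  "poly_diff p f t = (\<Sum>k\<le>degree p. coeff p k * (deriv ^^ k) f t)"

definition mat_diff :: "real poly mat \<Rightarrow> traj \<Rightarrow> real \<Rightarrow> real vec" where
  "mat_diff A x t =
     vec (dim_row A) (\<lambda>i. \<Sum>j<dim_col A. poly_diff (A $$ (i, j)) (\<lambda>s. x s $ j) t)"

definition ker_diff :: "real poly mat \<Rightarrow> traj set" where
  "ker_diff A = {x \<in> smooth_traj (dim_col A). \<forall>t. mat_diff A x t = 0\<^sub>v (dim_row A)}"

definition behavior :: "nat \<Rightarrow> traj set \<Rightarrow> bool" where
  "behavior q B \<longleftrightarrow> (\<exists>g. \<exists>A \<in> carrier_mat g q. B = ker_diff A)"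

text \<open>The rank over the field of rational functions; in the library, the first explicit
  argument of \<open>vec_space.rank\<close> is the number of rows.\<close>

definition poly_rank :: "real poly mat \<Rightarrow> nat" where
  "poly_rank A = vec_space.rank (dim_row A) (map_mat to_fract A)"

definition full_row_rank :: "real poly mat \<Rightarrow> bool" where
  "full_row_rank A \<longleftrightarrow> poly_rank A = dim_row A"

definition full_plant ::
  "real poly mat \<Rightarrow> real poly mat \<Rightarrow> (traj \<times> traj) set" where
  "full_plant R M = {(w, c). w \<in> smooth_traj (dim_col R) \<and> c \<in> smooth_traj (dim_col M) \<and>
     (\<forall>t. mat_diff R w t + mat_diff M c t = 0\<^sub>v (dim_row R))}"

text \<open>Smoothness of \<open>w\<close> and \<open>c\<close> in the next two definitions is part of membership in the
  full plant behavior.\<close>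

definition control_manifest ::
  "(traj \<times> traj) set \<Rightarrow> traj set" where
  "control_manifest P = {c. \<exists>w. (w, c) \<in> P}"

definition canonical_controller ::
  "(traj \<times> traj) set \<Rightarrow> traj set
    \<Rightarrow> traj set" where
  "canonical_controller P S = {c. \<exists>w \<in> S. (w, c) \<in> P}"

text \<open>Regularity is independent of the choice of the full row rank representation \<open>C\<close>, so it
  is stated for some representation. The matrix with block rows \<open>[R M]\<close> and \<open>[0 C]\<close> is a
  \<open>four_block_mat\<close>; the matrix \<open>[R M]\<close> is one whose lower blocks have no rows.\<close>

definition regular_controller ::
  "real poly mat \<Rightarrow> real poly mat \<Rightarrow> traj set \<Rightarrow> bool" where
  "regular_controller R M K \<longleftrightarrow>
     (\<exists>k. \<exists>C \<in> carrier_mat k (dim_col M). full_row_rank C \<and> K = ker_diff C \<and>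
        poly_rank (four_block_mat R M (0\<^sub>m k (dim_col R)) C) =
        poly_rank (four_block_mat R M (0\<^sub>m 0 (dim_col R)) (0\<^sub>m 0 (dim_col M))) + poly_rank C)"

definition can_reg ::
  "real poly mat \<Rightarrow> real poly mat \<Rightarrow> traj set \<Rightarrow> traj set set" where
  "can_reg R M S = {K. regular_controller R M K \<and>
     K \<inter> control_manifest (full_plant R M) =
       canonical_controller (full_plant R M) S \<inter> control_manifest (full_plant R M)}"

end

theory Submission
  imports
    "HOL-Analysis.Interval_Integral"
    "HOL-Computational_Algebra.Fundamental_Theorem_Algebra"
    Defs
begin

text \<open>
  The theorem is a statement about row modules of polynomial matrices, once kernels are known to
  determine these modules: if \<open>ker A \<subseteq> ker B\<close> then \<open>B = L A\<close> for a polynomial matrix \<open>L\<close>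
  (\<open>ker_diff_subset_imp_left_multiple\<close>). This holds because the smooth functions form an injective
  cogenerator over \<open>\<real>[\<xi>]\<close>. Nonzero polynomial operators are surjective on smooth functions
  (\<open>act_surj\<close>) and operators of positive degree have nonzero kernels (\<open>act_kernel_nonzero\<close>), as one sees
  from variation of constants for real linear and quadratic factors. Surjectivity lets one
  solve every consistent system one unknown at a time (\<open>solve_consistent_system\<close>), and a nonzero
  kernel element is the value given to a row outside a row module (\<open>separating_solution\<close>).

  Next, regularity is expressed through \<open>Pc\<close>. Over the field of rational functions,
  \<open>rank [X; Y] = rank X + k\<close> for a matrix \<open>Y\<close> with \<open>k\<close> rows says that the rows of \<open>Y\<close> are independent modulo
  the row space of \<open>X\<close> (\<open>rank_append_rows_iff\<close>), and denominators can be cleared. For \<open>X = [R M]\<close> and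
  \<open>Y = [0 C]\<close> this concerns the rows \<open>L M\<close> with \<open>L R = 0\<close>. These are the equations for \<open>c\<close> alone that
  follow from the plant, and by the kernel property they are the combinations of the rows of \<open>Pc\<close>.
  Thus a controller is regular if and only if it has a representation \<open>C\<close> whose rows are independent
  modulo those of \<open>Pc\<close> (\<open>regular_controller_iff\<close>).

  Finally, let \<open>C\<close> and \<open>C'\<close> be such representations of two controllers with the same intersection
  with \<open>P\<^sub>c\<close>, the kernel of \<open>Pc\<close>. The
  stacked matrices \<open>[Pc; C]\<close> and \<open>[Pc; C']\<close> have the same row module, so \<open>C' = X Pc + Y C\<close> and
  \<open>C = X' Pc + Y' C'\<close>. Independence modulo \<open>Pc\<close> forces \<open>Y Y' = 1\<close>; hence the kernel
  of \<open>C'\<close> is that of \<open>Y' C' = C - X' Pc\<close> (\<open>ker_diff_parametrization\<close>). Conversely, adding multiples of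
  the rows of \<open>Pc\<close> to \<open>C\<close> changes neither the independence modulo \<open>Pc\<close> nor the intersection with \<open>P\<^sub>c\<close>.
\<close>

section \<open>Smooth functions as a module over the polynomial ring\<close>

lemma smooth_fun_unfold:
  "smooth_fun f \<longleftrightarrow> (\<forall>t. f differentiable (at t)) \<and> smooth_fun (deriv f)"
proof -
  have "(\<forall>n. P n) \<longleftrightarrow> P 0 \<and> (\<forall>n. P (Suc n))" for P :: "nat \<Rightarrow> bool"
    by (metis not0_implies_Suc)
  from this[of "\<lambda>n. \<forall>t. (deriv ^^ n) f differentiable (at t)"] show ?thesis
    by (simp add: smooth_fun_def funpow_swap1)
qed

text \<open>
  Smoothness is the largest property of differentiable functions that is stable under
  differentiation. To see that a function
  is smooth it is thus enough to exhibit a class of functions that contains it and is closed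
  under derivatives, and no formula for the higher derivatives is needed.
\<close>

lemma smooth_fun_coinduct:
  assumes "f \<in> Q"
    and "\<And>g. g \<in> Q \<Longrightarrow> \<exists>g' \<in> Q. \<forall>t. (g has_real_derivative g' t) (at t)"
  shows "smooth_fun f"
proof -
  have "(deriv ^^ n) f \<in> Q" for n
  proof (induction n)
    case (Suc n)
    obtain g' where "g' \<in> Q" "\<forall>t. ((deriv ^^ n) f has_real_derivative g' t) (at t)"
      using assms(2)[OF Suc] by blast
    moreover from this have "deriv ((deriv ^^ n) f) = g'"
      using DERIV_imp_deriv by blast
    ultimately show ?case by simp
  qed (use assms(1) in simp)
  then show ?thesis
    unfolding smooth_fun_def using assms(2) real_differentiable_def by blast
qed

lemma smooth_fun_DERIV:
  assumes "smooth_fun f"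
  shows "(f has_real_derivative deriv f t) (at t)"
  using assms smooth_fun_unfold[of f] DERIV_deriv_iff_real_differentiable by blast

lemma smooth_fun_deriv: "smooth_fun f \<Longrightarrow> smooth_fun (deriv f)"
  using smooth_fun_unfold by blast

lemma smooth_fun_const: "smooth_fun (\<lambda>t. c)"
  by (rule smooth_fun_coinduct[where Q = "range (\<lambda>c t. c)"]) (auto intro!: derivative_eq_intros)

lemma smooth_fun_add:
  assumes "smooth_fun f" "smooth_fun g"
  shows "smooth_fun (\<lambda>t. f t + g t)"
proof (rule smooth_fun_coinduct)
  show "(\<lambda>t. f t + g t) \<in> {\<lambda>t. f t + g t | f g. smooth_fun f \<and> smooth_fun g}"
    using assms by blast
  fix h assume "h \<in> {\<lambda>t. f t + g t | f g. smooth_fun f \<and> smooth_fun g}"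
  then obtain f g where "h = (\<lambda>t. f t + g t)" "smooth_fun f" "smooth_fun g" by blast
  then show "\<exists>g'\<in>{\<lambda>t. f t + g t | f g. smooth_fun f \<and> smooth_fun g}. \<forall>t. (h has_real_derivative g' t) (at t)"
    by (intro bexI[of _ "\<lambda>t. deriv f t + deriv g t"])
      (auto intro: DERIV_add smooth_fun_DERIV smooth_fun_deriv)
qed

lemma smooth_fun_cmult:
  assumes "smooth_fun f"
  shows "smooth_fun (\<lambda>t. c * f t)"
proof (rule smooth_fun_coinduct)
  show "(\<lambda>t. c * f t) \<in> {\<lambda>t. c * f t | f. smooth_fun f}"
    using assms by blast
  fix h assume "h \<in> {\<lambda>t. c * f t | f. smooth_fun f}"
  then obtain f where "h = (\<lambda>t. c * f t)" "smooth_fun f" by blast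
  then show "\<exists>g'\<in>{\<lambda>t. c * f t | f. smooth_fun f}. \<forall>t. (h has_real_derivative g' t) (at t)"
    by (intro bexI[of _ "\<lambda>t. c * deriv f t"])
      (auto intro: DERIV_cmult smooth_fun_DERIV smooth_fun_deriv)
qed

text \<open>
  Having the smooth functions as a type makes them a real vector space on which differentiation and
  all polynomial differential operators are total, so that module computations carry no
  smoothness side conditions.
\<close>

typedef smooth = "{f :: real \<Rightarrow> real. smooth_fun f}"
  morphisms fun_of Smooth
  using smooth_fun_const by blast

setup_lifting type_definition_smooth

instantiation smooth :: real_vector
begin

lift_definition zero_smooth :: smooth is "\<lambda>t. 0" by (rule smooth_fun_const)
lift_definition plus_smooth :: "smooth \<Rightarrow> smooth \<Rightarrow> smooth" is "\<lambda>f g t. f t + g t"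
  by (rule smooth_fun_add)
lift_definition uminus_smooth :: "smooth \<Rightarrow> smooth" is "\<lambda>f t. - f t"
  using smooth_fun_cmult[of _ "-1"] by simp
lift_definition minus_smooth :: "smooth \<Rightarrow> smooth \<Rightarrow> smooth" is "\<lambda>f g t. f t - g t"
  using smooth_fun_add[OF _ smooth_fun_cmult[of _ "-1"]] by simp
lift_definition scaleR_smooth :: "real \<Rightarrow> smooth \<Rightarrow> smooth" is "\<lambda>c f t. c * f t"
  by (rule smooth_fun_cmult)

instance
  by standard (transfer; simp add: algebra_simps)+

end

lemma fun_of_sum: "fun_of (sum f I) t = (\<Sum>i\<in>I. fun_of (f i) t)"
  by (induction I rule: infinite_finite_induct) (simp_all add: zero_smooth.rep_eq plus_smooth.rep_eq)

lift_definition ddt :: "smooth \<Rightarrow> smooth" is deriv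
  by (rule smooth_fun_deriv)

lemma ddt_eqI:
  assumes "\<And>t. (fun_of F has_real_derivative fun_of G t) (at t)"
  shows "ddt F = G"
  by (metis DERIV_imp_deriv ddt.rep_eq assms ext fun_of_inject)

lemma fun_of_DERIV: "(fun_of F has_real_derivative fun_of (ddt F) t) (at t)"
  by transfer (rule smooth_fun_DERIV)

lemma linear_ddt: "linear ddt"
proof (rule linearI)
  show "ddt (F + G) = ddt F + ddt G" for F G
    by (rule ddt_eqI) (auto simp: plus_smooth.rep_eq intro: DERIV_add fun_of_DERIV)
  show "ddt (c *\<^sub>R F) = c *\<^sub>R ddt F" for c F
    by (rule ddt_eqI) (auto simp: scaleR_smooth.rep_eq intro: DERIV_cmult fun_of_DERIV)
qed

definition act :: "real poly \<Rightarrow> smooth \<Rightarrow> smooth" (infixr "\<bullet>\<^sub>D" 75) where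
  "p \<bullet>\<^sub>D F = (\<Sum>k\<le>degree p. coeff p k *\<^sub>R (ddt ^^ k) F)"

lemma fun_of_ddt_pow: "fun_of ((ddt ^^ k) F) = (deriv ^^ k) (fun_of F)"
  by (induction k) (simp_all add: ddt.rep_eq)

lemma fun_of_act: "fun_of (p \<bullet>\<^sub>D F) = poly_diff p (fun_of F)"
  by (rule ext) (simp add: act_def poly_diff_def fun_of_sum scaleR_smooth.rep_eq fun_of_ddt_pow)

text \<open>
  Any bound on the degree can replace the degree in the definition; polynomials of
  different degrees can thus be compared coefficient by coefficient.
\<close>

lemma act_eq_sum_bound: 
  assumes "degree p \<le> n" shows "p \<bullet>\<^sub>D F = (\<Sum>k\<le>n. coeff p k *\<^sub>R (ddt ^^ k) F)"
  unfolding act_def by (rule sum.mono_neutral_left) (use assms in \<open>auto simp: coeff_eq_0\<close>)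

lemma act_add_left: "(p + q) \<bullet>\<^sub>D F = p \<bullet>\<^sub>D F + q \<bullet>\<^sub>D F"
  using act_eq_sum_bound[of p "max (degree p) (degree q)" F]
    act_eq_sum_bound[of q "max (degree p) (degree q)" F]
    act_eq_sum_bound[of "p + q" "max (degree p) (degree q)" F] degree_add_le_max[of p q]
  by (simp add: scaleR_add_left sum.distrib)

lemma act_smult_left: "Polynomial.smult c p \<bullet>\<^sub>D F = c *\<^sub>R (p \<bullet>\<^sub>D F)"
  using act_eq_sum_bound[of "Polynomial.smult c p" "degree p" F] degree_smult_le[of c p]
  by (simp add: act_def scaleR_sum_right)

lemma act_zero_left [simp]: "0 \<bullet>\<^sub>D F = 0"
  by (simp add: act_def)

lemma act_pCons: "pCons a p \<bullet>\<^sub>D F = a *\<^sub>R F + ddt (p \<bullet>\<^sub>D F)"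
proof -
  have "pCons a p \<bullet>\<^sub>D F = (\<Sum>k\<le>Suc (degree p). coeff (pCons a p) k *\<^sub>R (ddt ^^ k) F)"
    by (rule act_eq_sum_bound) (rule degree_pCons_le)
  also have "\<dots> = a *\<^sub>R F + (\<Sum>k\<le>degree p. coeff p k *\<^sub>R ddt ((ddt ^^ k) F))"
    by (simp add: sum.atMost_Suc_shift del: sum.atMost_Suc)
  also have "(\<Sum>k\<le>degree p. coeff p k *\<^sub>R ddt ((ddt ^^ k) F)) = ddt (p \<bullet>\<^sub>D F)"
    by (simp add: act_def linear_sum[OF linear_ddt] linear_scale[OF linear_ddt])
  finally show ?thesis .
qed

lemma act_one [simp]: "1 \<bullet>\<^sub>D F = F"
  by (simp add: act_def)

lemma act_add_right: "p \<bullet>\<^sub>D (F + G) = p \<bullet>\<^sub>D F + p \<bullet>\<^sub>D G"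
  by (induction p) (simp_all add: act_pCons scaleR_add_right linear_add[OF linear_ddt])

lemma act_zero_right [simp]: "p \<bullet>\<^sub>D 0 = 0"
  using act_add_right[of p 0 0] by simp

lemma act_sum_right: "p \<bullet>\<^sub>D (sum f I) = (\<Sum>i\<in>I. p \<bullet>\<^sub>D f i)"
  by (induction I rule: infinite_finite_induct) (simp_all add: act_add_right)

lemma act_sum_left: "sum p I \<bullet>\<^sub>D F = (\<Sum>i\<in>I. p i \<bullet>\<^sub>D F)"
  by (induction I rule: infinite_finite_induct) (simp_all add: act_add_left)

lemma act_minus_left: "(- p) \<bullet>\<^sub>D F = - (p \<bullet>\<^sub>D F)"
  using act_smult_left[of "-1" p F] by simp

lemma act_diff_left: "(p - q) \<bullet>\<^sub>D F = p \<bullet>\<^sub>D F - q \<bullet>\<^sub>D F"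
  using act_add_left[of p "- q" F] by (simp add: act_minus_left)

lemma act_diff_right: "p \<bullet>\<^sub>D (F - G) = p \<bullet>\<^sub>D F - p \<bullet>\<^sub>D G"
  using act_add_right[of p "F - G" G] by (simp add: algebra_simps)

text \<open>
  With additivity, this makes the smooth functions a module over the ring of
  real polynomials, with the indeterminate acting as differentiation.
\<close>

lemma act_mult: "(p * q) \<bullet>\<^sub>D F = p \<bullet>\<^sub>D q \<bullet>\<^sub>D F"
  by (induction p) (simp_all add: act_add_left act_smult_left act_pCons)

lemma continuous_antiderivative:
  fixes f :: "real \<Rightarrow> real"
  assumes "\<And>t. isCont f t"
  obtains g where "\<And>t. (g has_real_derivative f t) (at t)"
  using einterval_antiderivative[of "-\<infinity>" "\<infinity>" f] assms
  by (auto simp: has_real_derivative_iff_has_vector_derivative)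

text \<open>
  Bootstrapping: the combinations \<open>\<alpha> y + \<beta> z + h\<close> with \<open>h\<close> smooth are closed under
  differentiation, because the equations express the derivatives of \<open>y\<close> and \<open>z\<close> by such combinations.
\<close>

lemma linear_system_smooth:
  assumes y: "\<And>t. (y has_real_derivative a * y t + b * z t + fun_of F t) (at t)"
    and z: "\<And>t. (z has_real_derivative c * y t + d * z t + fun_of G t) (at t)"
  shows "smooth_fun y"
proof (rule smooth_fun_coinduct)
  let ?Q = "{\<lambda>t. \<alpha> * y t + \<beta> * z t + fun_of H t | \<alpha> \<beta> H. True}"
  have "y = (\<lambda>t. 1 * y t + 0 * z t + fun_of 0 t)" by (simp add: zero_smooth.rep_eq)
  then show "y \<in> ?Q" by blast
  fix h assume "h \<in> ?Q"
  then obtain \<alpha> \<beta> H where h: "h = (\<lambda>t. \<alpha> * y t + \<beta> * z t + fun_of H t)" by blast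
  let ?h' = "\<lambda>t. (\<alpha> * a + \<beta> * c) * y t + (\<alpha> * b + \<beta> * d) * z t
     + fun_of (\<alpha> *\<^sub>R F + \<beta> *\<^sub>R G + ddt H) t"
  have "(h has_real_derivative ?h' t) (at t)" for t
    unfolding h by (rule derivative_eq_intros y z fun_of_DERIV refl)+
      (simp add: plus_smooth.rep_eq scaleR_smooth.rep_eq algebra_simps)
  then show "\<exists>g'\<in>?Q. \<forall>t. (h has_real_derivative g' t) (at t)"
    by (intro bexI[of _ ?h']) blast+
qed

lemma linear_system_solution:
  assumes "\<And>t. (y has_real_derivative a * y t + b * z t + fun_of F t) (at t)"
    and "\<And>t. (z has_real_derivative c * y t + d * z t + fun_of G t) (at t)"
  obtains Y Z where "fun_of Y = y" "fun_of Z = z"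
    "ddt Y = a *\<^sub>R Y + b *\<^sub>R Z + F" "ddt Z = c *\<^sub>R Y + d *\<^sub>R Z + G"
proof -
  have "smooth_fun y" using linear_system_smooth[OF assms] .
  have "smooth_fun z"
    by (rule linear_system_smooth[where y = z and z = y and a = d and b = c and F = G and c = b and d = a and G = F])
      (use assms in \<open>simp_all add: add.commute\<close>)
  have YZ: "fun_of (Smooth y) = y" "fun_of (Smooth z) = z"
    using \<open>smooth_fun y\<close> \<open>smooth_fun z\<close> by (simp_all add: Smooth_inverse)
  then have "ddt (Smooth y) = a *\<^sub>R Smooth y + b *\<^sub>R Smooth z + F"
    "ddt (Smooth z) = c *\<^sub>R Smooth y + d *\<^sub>R Smooth z + G"
    using assms by (auto intro!: ddt_eqI simp: plus_smooth.rep_eq scaleR_smooth.rep_eq)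
  with YZ show thesis using that by blast
qed

lemma ddt_zero [simp]: "ddt 0 = 0"
  by (rule linear_0[OF linear_ddt])

lemma act_linear: "[:- a, 1:] \<bullet>\<^sub>D Y = ddt Y - a *\<^sub>R Y"
  by (simp add: act_pCons)

text \<open>
  The quadratic is \<open>(\<xi> - a)\<^sup>2 + b\<^sup>2\<close>, the minimal polynomial of \<open>a + b i\<close>; with \<open>Z = (d/dt - a) Y\<close> the
  second-order equation becomes a first-order system.
\<close>

lemma act_quadratic:
  assumes "ddt Y = a *\<^sub>R Y + Z" and "ddt Z = a *\<^sub>R Z - b\<^sup>2 *\<^sub>R Y + F"
  shows "[:a\<^sup>2 + b\<^sup>2, - 2 * a, 1:] \<bullet>\<^sub>D Y = F"
proof -
  have "[:a\<^sup>2 + b\<^sup>2, - 2 * a, 1:] \<bullet>\<^sub>D Y = (a\<^sup>2 + b\<^sup>2) *\<^sub>R Y + ddt ((- 2 * a) *\<^sub>R Y + ddt Y)"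
    by (simp add: act_pCons)
  also have "ddt ((- 2 * a) *\<^sub>R Y + ddt Y) = (- 2 * a) *\<^sub>R ddt Y + a *\<^sub>R ddt Y + ddt Z"
    by (simp only: assms(1) linear_add[OF linear_ddt] linear_scale[OF linear_ddt] add.assoc)
  also have "(a\<^sup>2 + b\<^sup>2) *\<^sub>R Y + ((- 2 * a) *\<^sub>R ddt Y + a *\<^sub>R ddt Y + ddt Z)
    = (a\<^sup>2 + b\<^sup>2) *\<^sub>R Y - a *\<^sub>R ddt Y + ddt Z"
    by (simp add: algebra_simps flip: scaleR_add_left)
  also have "\<dots> = F"
    by (simp add: assms algebra_simps power2_eq_square)
  finally show ?thesis .
qed

text \<open>
  Variation of constants with the integrating factor \<open>exp (- a t)\<close>.
\<close>

lemma act_linear_surj: "\<exists>Y. [:- a, 1:] \<bullet>\<^sub>D Y = F"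
proof -
  obtain I where I: "\<And>t. (I has_real_derivative exp (- a * t) * fun_of F t) (at t)"
    by (rule continuous_antiderivative[of "\<lambda>t. exp (- a * t) * fun_of F t"])
      (auto intro!: continuous_intros DERIV_isCont[OF fun_of_DERIV])
  have "((\<lambda>t. exp (a * t) * I t) has_real_derivative a * (exp (a * t) * I t) + 0 * 0 + fun_of F t) (at t)" for t
    by (rule derivative_eq_intros I refl)+ (simp add: exp_minus field_simps)
  then obtain Y Z where "ddt Y = a *\<^sub>R Y + 0 *\<^sub>R Z + F"
    by (rule linear_system_solution[where z = "\<lambda>t. 0" and c = 0 and d = 0 and G = 0])
      (auto simp: zero_smooth.rep_eq)
  then show ?thesis
    by (intro exI[of _ Y]) (simp add: act_linear)
qed

text \<open>
  Variation of constants with the fundamental solutions \<open>exp (a t) cos (b t)\<close> and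
  \<open>exp (a t) sin (b t)\<close>. Working with this real form avoids complex-valued functions.
\<close>

lemma act_quadratic_surj:
  assumes "b \<noteq> 0"
  shows "\<exists>Y. [:a\<^sup>2 + b\<^sup>2, - 2 * a, 1:] \<bullet>\<^sub>D Y = F"
proof -
  obtain I where I: "\<And>t. (I has_real_derivative exp (- a * t) * cos (b * t) * fun_of F t) (at t)"
    by (rule continuous_antiderivative[of "\<lambda>t. exp (- a * t) * cos (b * t) * fun_of F t"])
      (auto intro!: continuous_intros DERIV_isCont[OF fun_of_DERIV])
  obtain J where J: "\<And>t. (J has_real_derivative exp (- a * t) * sin (b * t) * fun_of F t) (at t)"
    by (rule continuous_antiderivative[of "\<lambda>t. exp (- a * t) * sin (b * t) * fun_of F t"])
      (auto intro!: continuous_intros DERIV_isCont[OF fun_of_DERIV])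
  \<comment> \<open>\<open>y\<close> is the convolution of \<open>F\<close> with \<open>exp (a t) sin (b t) / b\<close>, and \<open>z = y' - a y\<close>.\<close>
  define y where "y = (\<lambda>t. exp (a * t) * (sin (b * t) * I t - cos (b * t) * J t) / b)"
  define z where "z = (\<lambda>t. exp (a * t) * (cos (b * t) * I t + sin (b * t) * J t))"
  have y: "(y has_real_derivative a * y t + 1 * z t + fun_of 0 t) (at t)" for t
    unfolding y_def z_def
    by (rule derivative_eq_intros I J refl)+
      (use assms in \<open>simp_all add: zero_smooth.rep_eq field_simps\<close>)
  have z: "(z has_real_derivative (- b\<^sup>2) * y t + a * z t + fun_of F t) (at t)" for t
  proof -
    let ?e = "exp (a * t)" and ?c = "cos (b * t)" and ?s = "sin (b * t)"
    have "(z has_real_derivative a * ?e * (?c * I t + ?s * J t) +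
        ?e * (- b * ?s * I t + ?c * (exp (- a * t) * ?c * fun_of F t)
          + (b * ?c * J t + ?s * (exp (- a * t) * ?s * fun_of F t)))) (at t)"
      unfolding z_def
      by (rule derivative_eq_intros I J refl)+ (simp add: algebra_simps)
    also have "a * ?e * (?c * I t + ?s * J t) +
        ?e * (- b * ?s * I t + ?c * (exp (- a * t) * ?c * fun_of F t)
          + (b * ?c * J t + ?s * (exp (- a * t) * ?s * fun_of F t)))
      = a * z t - b\<^sup>2 * y t + ?e * exp (- a * t) * (?c\<^sup>2 + ?s\<^sup>2) * fun_of F t"
    proof -
      have "b\<^sup>2 * y t = b * (?e * (?s * I t - ?c * J t))"
        using assms by (simp add: y_def power2_eq_square)
      then show ?thesis
        by (simp only: z_def power2_eq_square ring_distribs) (simp add: algebra_simps)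
    qed
    also have "?e * exp (- a * t) * (?c\<^sup>2 + ?s\<^sup>2) = 1"
      by (simp add: exp_minus)
    finally show ?thesis by (simp add: algebra_simps)
  qed
  obtain Y Z where "ddt Y = a *\<^sub>R Y + 1 *\<^sub>R Z + 0" "ddt Z = (- b\<^sup>2) *\<^sub>R Y + a *\<^sub>R Z + F"
    using linear_system_solution[OF y z] by blast
  then show ?thesis
    by (intro exI[of _ Y] act_quadratic[where Z = Z]) simp_all
qed

lemma act_linear_kernel: "\<exists>Y. [:- a, 1:] \<bullet>\<^sub>D Y = 0 \<and> Y \<noteq> 0"
proof -
  have "((\<lambda>t. exp (a * t)) has_real_derivative a * exp (a * t) + 0 * 0 + fun_of 0 t) (at t)" for t
    by (rule derivative_eq_intros refl)+ (simp add: zero_smooth.rep_eq)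
  then obtain Y Z where "fun_of Y = (\<lambda>t. exp (a * t))" "ddt Y = a *\<^sub>R Y + 0 *\<^sub>R Z + 0"
    by (rule linear_system_solution[where z = "\<lambda>t. 0" and c = 0 and d = 0 and G = 0])
      (auto simp: zero_smooth.rep_eq)
  then show ?thesis
    by (intro exI[of _ Y]) (auto simp: act_linear zero_smooth.rep_eq dest: fun_cong[of _ _ 0])
qed

lemma act_quadratic_kernel: "\<exists>Y. [:a\<^sup>2 + b\<^sup>2, - 2 * a, 1:] \<bullet>\<^sub>D Y = 0 \<and> Y \<noteq> 0"
proof -
  define y z where "y = (\<lambda>t. exp (a * t) * cos (b * t))" and "z = (\<lambda>t. - b * exp (a * t) * sin (b * t))"
  have y: "(y has_real_derivative a * y t + 1 * z t + fun_of 0 t) (at t)" for t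
    unfolding y_def z_def
    by (rule derivative_eq_intros refl)+ (simp add: zero_smooth.rep_eq algebra_simps)
  have z: "(z has_real_derivative (- b\<^sup>2) * y t + a * z t + fun_of 0 t) (at t)" for t
    unfolding y_def z_def
    by (rule derivative_eq_intros refl)+
      (simp add: zero_smooth.rep_eq algebra_simps power2_eq_square)
  obtain Y Z where Y: "fun_of Y = y" "ddt Y = a *\<^sub>R Y + 1 *\<^sub>R Z + 0" "ddt Z = (- b\<^sup>2) *\<^sub>R Y + a *\<^sub>R Z + 0"
    using linear_system_solution[OF y z] by blast
  then have "[:a\<^sup>2 + b\<^sup>2, - 2 * a, 1:] \<bullet>\<^sub>D Y = 0"
    by (intro act_quadratic[where Z = Z]) simp_all
  moreover have "Y \<noteq> 0"
  proof
    assume "Y = 0"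
    then have "y 0 = 0" using Y(1) by (simp add: zero_smooth.rep_eq flip: Y(1))
    then show False by (simp add: y_def)
  qed
  ultimately show ?thesis by blast
qed

lemma poly_map_of_real_add:
  "poly (map_poly complex_of_real (p + q)) z =
    poly (map_poly of_real p) z + poly (map_poly of_real q) z"
proof -
  have "map_poly complex_of_real (p + q) = map_poly of_real p + map_poly of_real q"
    by (rule poly_eqI) (simp add: coeff_map_poly)
  then show ?thesis by simp
qed

lemma poly_map_of_real_mult:
  "poly (map_poly complex_of_real (p * q)) z =
    poly (map_poly of_real p) z * poly (map_poly of_real q) z"
proof (induction p)
  case (pCons a p)
  have "map_poly complex_of_real (Polynomial.smult a q) = Polynomial.smult (of_real a) (map_poly of_real q)"
    by (rule poly_eqI) (simp add: coeff_map_poly)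
  with pCons show ?case
    by (simp add: poly_map_of_real_add map_poly_pCons algebra_simps)
qed simp

text \<open>
  The real form of the fundamental theorem of algebra. At a complex root \<open>a + b i\<close> with \<open>b \<noteq> 0\<close>, the
  remainder modulo \<open>(\<xi> - a)\<^sup>2 + b\<^sup>2\<close> is a real polynomial of degree at most one that vanishes at a
  non-real number, hence is zero.
\<close>

lemma real_poly_factor:
  fixes p :: "real poly"
  assumes "degree p > 0"
  obtains a where "[:- a, 1:] dvd p" | a b where "b \<noteq> 0" "[:a\<^sup>2 + b\<^sup>2, - 2 * a, 1:] dvd p"
proof -
  let ?ev = "\<lambda>p. poly (map_poly complex_of_real p)"
  have "degree (map_poly complex_of_real p) = degree p"
    by (simp add: degree_map_poly)
  then obtain x where x: "?ev p x = 0"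
    using fundamental_theorem_of_algebra[of "map_poly complex_of_real p"] assms
    by (auto simp: constant_degree)
  define a b where "a = Re x" and "b = Im x"
  show thesis
  proof (cases "b = 0")
    case True
    then have "x = of_real a" by (simp add: a_def b_def complex_eq_iff)
    moreover have "?ev p (of_real a) = of_real (poly p a)"
      by (induction p) (simp_all add: map_poly_pCons)
    ultimately have "[:- a, 1:] dvd p"
      using x by (simp add: poly_eq_0_iff_dvd)
    then show thesis using that(1) by blast
  next
    case False
    let ?q = "[:a\<^sup>2 + b\<^sup>2, - 2 * a, 1:]"
    define r where "r = p mod ?q"
    have q: "?ev ?q x = 0"
      by (simp add: map_poly_pCons a_def b_def complex_eq_iff power2_eq_square algebra_simps)
    have "degree r < 2"
      using degree_mod_less'[of ?q p] by (cases "r = 0") (simp_all add: r_def)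
    then obtain u v where r: "r = [:u, v:]"
      by (metis (no_types) degree_eq_zeroE less_2_cases degree_pCons_eq_if pCons_cases degree_0 
        One_nat_def pCons_0_0 Suc_inject)
    have "p = ?q * (p div ?q) + r"
      unfolding r_def by (simp only: mult_div_mod_eq)
    then have "?ev p x = ?ev ?q x * ?ev (p div ?q) x + ?ev r x"
      by (metis poly_map_of_real_add poly_map_of_real_mult)
    then have "of_real u + x * of_real v = 0"
      using x q by (simp add: r map_poly_pCons)
    then have "u = 0" "v = 0"
      using False by (auto simp: complex_eq_iff a_def b_def)
    then have "?q dvd p"
      using r by (simp add: r_def dvd_eq_mod_eq_0)
    then show thesis using that(2) False by blast
  qed
qed

text \<open>
  Divisibility of the module of smooth functions: peel off one linear or quadratic factor
  at a time. This is what allows systems of differential equations to be solved one unknown at a time.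
\<close>

lemma act_surj:
  assumes "p \<noteq> 0"
  shows "\<exists>Y. p \<bullet>\<^sub>D Y = F"
  using assms
proof (induction "degree p" arbitrary: p F rule: less_induct)
  case less
  have step: "\<exists>Y. p \<bullet>\<^sub>D Y = F"
    if "q dvd p" "degree q > 0" and surj: "\<And>F. \<exists>Y. q \<bullet>\<^sub>D Y = F" for q
  proof -
    obtain r where p: "p = q * r" using \<open>q dvd p\<close> by (rule dvdE)
    with less.prems have "r \<noteq> 0" "degree r < degree p"
      using \<open>degree q > 0\<close> by (auto simp: degree_mult_eq)
    then show ?thesis
      using less.hyps[of r] surj by (metis act_mult p)
  qed
  show ?case
  proof (cases "degree p = 0")
    case True
    then obtain c where "p = [:c:]" by (rule degree_eq_zeroE)
    with less.prems have "p \<bullet>\<^sub>D ((1 / c) *\<^sub>R F) = F" by (simp add: act_pCons)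
    then show ?thesis by blast
  next
    case False
    then have "degree p > 0" by simp
    then show ?thesis
    proof (cases rule: real_poly_factor)
      case (1 a)
      then show ?thesis by (rule step) (simp_all add: act_linear_surj)
    next
      case (2 a b)
      show ?thesis by (rule step[OF 2(2)]) (use act_quadratic_surj[OF 2(1)] in simp_all)
    qed
  qed
qed

text \<open>
  Every cyclic module \<open>\<real>[\<xi>]/(p)\<close> that is not zero maps nontrivially to the smooth functions. Together with
  divisibility this makes the smooth functions a cogenerator: they can detect every polynomial row
  outside a given row module.
\<close>

lemma act_kernel_nonzero:
  assumes "\<not> p dvd 1"
  shows "\<exists>Y. p \<bullet>\<^sub>D Y = 0 \<and> Y \<noteq> 0"
proof (cases "p = 0")
  case True
  obtain Y :: smooth where "Y \<noteq> 0" using act_linear_kernel by blast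
  then show ?thesis using True by auto
next
  case False
  with assms have "degree p > 0"
    using is_unit_iff_degree[of p] by simp
  then obtain q Y where "q dvd p" "q \<bullet>\<^sub>D Y = 0" "Y \<noteq> 0"
    using act_linear_kernel act_quadratic_kernel by (metis real_poly_factor)
  then have "p \<bullet>\<^sub>D Y = 0"
    by (metis act_mult act_zero_right dvdE mult.commute)
  with \<open>Y \<noteq> 0\<close> show ?thesis by blast
qed

section \<open>Kernels of polynomial matrices determine their row modules\<close>

text \<open>
  A pair \<open>(u, F)\<close> stands for the equation \<open>u\<^sub>0 X\<^sub>0 + \<dots> + u\<^sub>q\<^sub>-\<^sub>1 X\<^sub>q\<^sub>-\<^sub>1 = F\<close>, and \<open>N\<close> is closed under
  polynomial combinations of equations. If no combination has a zero left-hand side and a nonzero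
  right-hand side, the system is solvable. This is Baer's argument that divisible modules over a
  principal ideal domain are injective: the equations without the last unknown are solved by induction;
  the last coefficients form an ideal, generated by one equation's coefficient, and divisibility
  gives a value of the last unknown that satisfies that equation, hence all others.
\<close>

lemma solve_consistent_system:
  fixes N :: "((nat \<Rightarrow> real poly) \<times> smooth) set"
  assumes zero: "((\<lambda>j. 0), 0) \<in> N"
    and comb: "\<And>r u F v G. (u, F) \<in> N \<Longrightarrow> (v, G) \<in> N \<Longrightarrow> ((\<lambda>j. u j + r * v j), F + r \<bullet>\<^sub>D G) \<in> N"
    and consistent: "\<And>u F. (u, F) \<in> N \<Longrightarrow> (\<And>j. j < q \<Longrightarrow> u j = 0) \<Longrightarrow> F = 0"
  shows "\<exists>X. \<forall>(u, F) \<in> N. (\<Sum>j<q. u j \<bullet>\<^sub>D X j) = F"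
  using assms
proof (induction q arbitrary: N)
  case 0
  then show ?case by auto
next
  case (Suc q)
  note zero = Suc.prems(1) and comb = Suc.prems(2) and consistent = Suc.prems(3)
  define N0 where "N0 = {(u, F) \<in> N. u q = 0}"
  have "\<exists>X. \<forall>(u, F) \<in> N0. (\<Sum>j<q. u j \<bullet>\<^sub>D X j) = F"
  proof (rule Suc.IH)
    show "((\<lambda>j. 0), 0) \<in> N0" using zero by (simp add: N0_def)
    show "((\<lambda>j. u j + r * v j), F + r \<bullet>\<^sub>D G) \<in> N0" if "(u, F) \<in> N0" "(v, G) \<in> N0" for r u F v G
      using that comb by (simp add: N0_def)
    show "F = 0" if "(u, F) \<in> N0" "\<And>j. j < q \<Longrightarrow> u j = 0" for u F
      using that consistent[of u F] by (auto simp: N0_def less_Suc_eq)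
  qed
  then obtain X where X: "(\<Sum>j<q. u j \<bullet>\<^sub>D X j) = F" if "(u, F) \<in> N" "u q = 0" for u F
    by (auto simp: N0_def)
  show ?case
  proof (cases "\<forall>(u, F) \<in> N. u q = 0")
    case True
    then show ?thesis
      using X by (intro exI[of _ "X(q := 0)"]) (auto intro!: X)
  next
    case False
    then obtain v G where v: "(v, G) \<in> N" "v q \<noteq> 0"
      and min: "\<And>u F. (u, F) \<in> N \<Longrightarrow> u q \<noteq> 0 \<Longrightarrow> degree (v q) \<le> degree (u q)"
      using ex_has_least_nat[of "\<lambda>n. \<exists>u F. (u, F) \<in> N \<and> u q \<noteq> 0 \<and> n = degree (u q)" _ "\<lambda>n. n"]
      by (auto; metis)
    have dvd: "v q dvd u q" if u: "(u, F) \<in> N" for u F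
    proof (rule ccontr)
      assume "\<not> v q dvd u q"
      \<comment> \<open>One step of Euclidean division would produce a smaller leading coefficient.\<close>
      let ?r = "- (u q div v q)"
      have "((\<lambda>j. u j + ?r * v j), F + ?r \<bullet>\<^sub>D G) \<in> N" by (rule comb[OF u v(1)])
      moreover have "u q + ?r * v q = u q mod v q"
        by (simp add: minus_div_mult_eq_mod)
      moreover have "u q mod v q \<noteq> 0" "degree (u q mod v q) < degree (v q)"
        using \<open>\<not> v q dvd u q\<close> v(2) degree_mod_less'[of "v q" "u q"] by (auto simp: dvd_eq_mod_eq_0)
      ultimately show False using min by force
    qed
    obtain Y where Y: "v q \<bullet>\<^sub>D Y = G - (\<Sum>j<q. v j \<bullet>\<^sub>D X j)"
      using act_surj[OF v(2)] by blast
    have "(\<Sum>j<Suc q. u j \<bullet>\<^sub>D (X(q := Y)) j) = F" if u: "(u, F) \<in> N" for u F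
    proof -
      obtain r where r: "u q = v q * r" using dvd[OF u] by (rule dvdE)
      have "(\<Sum>j<q. (u j + (- r) * v j) \<bullet>\<^sub>D X j) = F + (- r) \<bullet>\<^sub>D G"
        by (rule X[OF comb[OF u v(1)]]) (simp add: r)
      then have "(\<Sum>j<q. u j \<bullet>\<^sub>D X j) = F - r \<bullet>\<^sub>D G + r \<bullet>\<^sub>D (\<Sum>j<q. v j \<bullet>\<^sub>D X j)"
        by (simp add: act_diff_left act_minus_left act_mult act_sum_right sum_subtractf algebra_simps)
      moreover have "u q \<bullet>\<^sub>D Y = r \<bullet>\<^sub>D G - r \<bullet>\<^sub>D (\<Sum>j<q. v j \<bullet>\<^sub>D X j)"
        by (simp add: r mult.commute[of _ r] act_mult Y act_diff_right)
      ultimately show ?thesis by simp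
    qed
    then show ?thesis by blast
  qed
qed

text \<open>
  The multiples \<open>r\<close> for which \<open>r b\<close> lies in the row module \<open>S\<close> form a proper ideal \<open>(d)\<close>.
  Choose \<open>Y \<noteq> 0\<close> with \<open>d Y = 0\<close>; demanding that \<open>S\<close> gives zero and that \<open>b\<close> gives \<open>Y\<close> is then
  consistent, because \<open>r b \<in> S\<close> forces \<open>r Y = 0\<close>.
\<close>

lemma separating_solution:
  fixes S :: "(nat \<Rightarrow> real poly) set"
  assumes zero: "(\<lambda>j. 0) \<in> S"
    and comb: "\<And>r u v. u \<in> S \<Longrightarrow> v \<in> S \<Longrightarrow> (\<lambda>j. u j + r * v j) \<in> S"
    and notin: "\<And>u. u \<in> S \<Longrightarrow> \<exists>j<q. u j \<noteq> b j"
  shows "\<exists>X. (\<forall>u\<in>S. (\<Sum>j<q. u j \<bullet>\<^sub>D X j) = 0) \<and> (\<Sum>j<q. b j \<bullet>\<^sub>D X j) \<noteq> 0"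
proof -
  define I where "I = {r. \<exists>u\<in>S. \<forall>j<q. u j = r * b j}"
  have I_comb: "r + c * s \<in> I" if rs: "r \<in> I" "s \<in> I" for r s c
  proof -
    obtain u v where "u \<in> S" "v \<in> S" "\<forall>j<q. u j = r * b j" "\<forall>j<q. v j = s * b j"
      using rs by (auto simp: I_def)
    then show ?thesis
      unfolding I_def using comb[of u v c] by (auto intro!: bexI[of _ "\<lambda>j. u j + c * v j"] simp: algebra_simps)
  qed
  have "0 \<in> I" using zero by (auto simp: I_def)
  obtain d where d: "d \<in> I" "\<And>r. r \<in> I \<Longrightarrow> d dvd r"
  proof (cases "I = {0}")
    case False
    then have "\<exists>r. r \<in> I \<and> r \<noteq> 0" using \<open>0 \<in> I\<close> by blast
    then obtain d where d: "d \<in> I" "d \<noteq> 0" and min: "\<And>r. r \<in> I \<Longrightarrow> r \<noteq> 0 \<Longrightarrow> degree d \<le> degree r"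
      using ex_has_least_nat[of "\<lambda>r. r \<in> I \<and> r \<noteq> 0" _ degree] by metis
    have "d dvd r" if "r \<in> I" for r
    proof (rule ccontr)
      assume "\<not> d dvd r"
      moreover have "r mod d \<in> I"
        using I_comb[OF that d(1), of "- (r div d)"] by (simp add: minus_div_mult_eq_mod)
      ultimately show False
        using min[of "r mod d"] degree_mod_less'[of d r] d(2) by (auto simp: dvd_eq_mod_eq_0)
    qed
    then show thesis using that d(1) by blast
  qed (use that in auto)
  have "\<not> d dvd 1"
  proof
    assume "d dvd 1"
    then obtain e where "1 = d * e" by (rule dvdE)
    then have "1 \<in> I" using I_comb[OF \<open>0 \<in> I\<close> d(1), of e] by (simp add: mult.commute)
    then show False using notin by (auto simp: I_def)
  qed
  then obtain Y where Y: "d \<bullet>\<^sub>D Y = 0" "Y \<noteq> 0" using act_kernel_nonzero by blast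
  \<comment> \<open>The system that asks for the value \<open>0\<close> on \<open>S\<close> and the value \<open>Y\<close> on \<open>b\<close>.\<close>
  define N where "N = {((\<lambda>j. u j + r * b j), r \<bullet>\<^sub>D Y) | u r. u \<in> S}"
  have "\<exists>X. \<forall>(u, F) \<in> N. (\<Sum>j<q. u j \<bullet>\<^sub>D X j) = F"
  proof (rule solve_consistent_system)
    show "((\<lambda>j. 0), 0) \<in> N"
      unfolding N_def using zero by (auto intro!: exI[of _ "\<lambda>j. 0"] exI[of _ 0])
  next
    fix r u F v G assume "(u, F) \<in> N" "(v, G) \<in> N"
    then obtain u' v' s t where "u' \<in> S" "v' \<in> S" "u = (\<lambda>j. u' j + s * b j)" "v = (\<lambda>j. v' j + t * b j)"
      "F = s \<bullet>\<^sub>D Y" "G = t \<bullet>\<^sub>D Y"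
      by (auto simp: N_def)
    then show "((\<lambda>j. u j + r * v j), F + r \<bullet>\<^sub>D G) \<in> N"
      unfolding N_def using comb[of u' v' r]
      by (auto intro!: exI[of _ "\<lambda>j. u' j + r * v' j"] exI[of _ "s + r * t"]
          simp: act_add_left act_mult algebra_simps)
  next
    fix u F assume "(u, F) \<in> N" and u0: "\<And>j. j < q \<Longrightarrow> u j = 0"
    then obtain v r where v: "v \<in> S" "u = (\<lambda>j. v j + r * b j)" "F = r \<bullet>\<^sub>D Y"
      by (auto simp: N_def)
    then have "- r \<in> I"
      using u0 unfolding I_def by (auto intro!: bexI[of _ v] simp: eq_neg_iff_add_eq_0)
    then have "d dvd r" using d(2) by force
    then obtain e where "r = e * d" by (metis dvdE mult.commute)
    then show "F = 0" using v(3) Y(1) by (simp add: act_mult)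
  qed
  then obtain X where "\<forall>(u, F) \<in> N. (\<Sum>j<q. u j \<bullet>\<^sub>D X j) = F" ..
  from bspec[OF this] have X: "(\<Sum>j<q. u j \<bullet>\<^sub>D X j) = F" if "(u, F) \<in> N" for u F
    using that by fastforce
  show ?thesis
  proof (intro exI[of _ X] conjI ballI)
    show "(\<Sum>j<q. u j \<bullet>\<^sub>D X j) = 0" if "u \<in> S" for u
      by (rule X) (use that in \<open>auto simp: N_def intro!: exI[of _ u] exI[of _ 0]\<close>)
    have "(\<Sum>j<q. b j \<bullet>\<^sub>D X j) = 1 \<bullet>\<^sub>D Y"
      by (rule X) (use zero in \<open>auto simp: N_def intro!: exI[of _ "\<lambda>j. 0"] exI[of _ 1]\<close>)
    then show "(\<Sum>j<q. b j \<bullet>\<^sub>D X j) \<noteq> 0" using Y(2) by simp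
  qed
qed

definition component :: "traj \<Rightarrow> nat \<Rightarrow> smooth" where
  "component x j = Smooth (\<lambda>t. x t $ j)"

text \<open>
  The action of a polynomial matrix on a sequence of smooth functions; only the first
  \<open>dim_col A\<close> entries of the sequence matter. Sequences are used instead of vectors so that actions
  compose without dimension conditions on the trajectory.
\<close>

definition mat_act :: "real poly mat \<Rightarrow> (nat \<Rightarrow> smooth) \<Rightarrow> nat \<Rightarrow> smooth" where
  "mat_act A X i = (\<Sum>j<dim_col A. A $$ (i, j) \<bullet>\<^sub>D X j)"

definition traj_of :: "nat \<Rightarrow> (nat \<Rightarrow> smooth) \<Rightarrow> traj" where
  "traj_of q X t = Matrix.vec q (\<lambda>j. fun_of (X j) t)"

lemma traj_of_smooth: "traj_of q X \<in> smooth_traj q"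
  using fun_of[of "X _"] by (auto simp: smooth_traj_def traj_of_def cong: if_cong)

lemma component_traj_of: "j < q \<Longrightarrow> component (traj_of q X) j = X j"
  by (simp add: component_def traj_of_def fun_of_inverse)

lemma fun_of_component: "x \<in> smooth_traj q \<Longrightarrow> j < q \<Longrightarrow> fun_of (component x j) t = x t $ j"
  by (simp add: component_def smooth_traj_def Smooth_inverse)

lemma mat_diff_eq:
  assumes "x \<in> smooth_traj (dim_col A)"
  shows "mat_diff A x t = Matrix.vec (dim_row A) (\<lambda>i. fun_of (mat_act A (component x) i) t)"
proof (rule eq_vecI)
  fix i assume "i < dim_vec (Matrix.vec (dim_row A) (\<lambda>i. fun_of (mat_act A (component x) i) t))"
  moreover have "fun_of (component x j) = (\<lambda>s. x s $ j)" if "j < dim_col A" for j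
    using fun_of_component[OF assms that] by (rule ext)
  ultimately show "mat_diff A x t $ i = Matrix.vec (dim_row A) (\<lambda>i. fun_of (mat_act A (component x) i) t) $ i"
    by (simp add: mat_diff_def mat_act_def fun_of_sum fun_of_act)
qed (simp add: mat_diff_def)

text \<open>
  The bridge between vector-valued trajectories and the module of smooth functions.
\<close>

lemma ker_diff_iff:
  "x \<in> ker_diff A \<longleftrightarrow> x \<in> smooth_traj (dim_col A) \<and> (\<forall>i<dim_row A. mat_act A (component x) i = 0)"
proof -
  have "(\<forall>t. Matrix.vec n (\<lambda>i. fun_of (Y i) t) = 0\<^sub>v n) \<longleftrightarrow> (\<forall>i<n. Y i = 0)" for n and Y :: "nat \<Rightarrow> smooth"
    by (auto simp: vec_eq_iff zero_smooth.rep_eq simp flip: fun_of_inject)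
  then show ?thesis
    by (cases "x \<in> smooth_traj (dim_col A)") (simp_all add: ker_diff_def mat_diff_eq)
qed

lemma mat_act_cong: "(\<And>j. j < dim_col A \<Longrightarrow> X j = Y j) \<Longrightarrow> mat_act A X = mat_act A Y"
  by (auto simp: mat_act_def)

lemma mat_act_mult:
  assumes "dim_col L = dim_row A" "i < dim_row L"
  shows "mat_act (L * A) X i = mat_act L (mat_act A X) i"
proof -
  have "mat_act (L * A) X i = (\<Sum>j<dim_col A. \<Sum>k<dim_row A. L $$ (i, k) \<bullet>\<^sub>D A $$ (k, j) \<bullet>\<^sub>D X j)"
    using assms by (simp add: mat_act_def scalar_prod_def atLeast0LessThan act_sum_left act_mult)
  also have "\<dots> = (\<Sum>k<dim_row A. \<Sum>j<dim_col A. L $$ (i, k) \<bullet>\<^sub>D A $$ (k, j) \<bullet>\<^sub>D X j)"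
    by (rule sum.swap)
  also have "\<dots> = mat_act L (mat_act A X) i"
    using assms by (simp add: mat_act_def act_sum_right)
  finally show ?thesis .
qed

lemma mat_act_zero:
  assumes "\<And>j. j < dim_col L \<Longrightarrow> X j = 0"
  shows "mat_act L X i = 0"
  using assms by (simp add: mat_act_def)

lemma ker_diff_mult:
  assumes "dim_col L = dim_row A"
  shows "ker_diff A \<subseteq> ker_diff (L * A)"
proof
  fix x assume x: "x \<in> ker_diff A"
  with assms have "mat_act L (mat_act A (component x)) i = 0" for i
    by - (rule mat_act_zero, simp add: ker_diff_iff)
  with x assms show "x \<in> ker_diff (L * A)"
    by (simp add: ker_diff_iff mat_act_mult)
qed

text \<open>
  A row of \<open>B\<close> outside the row module of \<open>A\<close> would be separated from it by a trajectory, which would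
  lie in the kernel of \<open>A\<close> but not in that of \<open>B\<close>. Through this statement, and only through it,
  the solvability of differential equations enters the theorem.
\<close>

proposition ker_diff_subset_imp_left_multiple:
  assumes A: "A \<in> carrier_mat g q" and B: "B \<in> carrier_mat h q"
    and sub: "ker_diff A \<subseteq> ker_diff B"
  obtains L where "L \<in> carrier_mat h g" "B = L * A"
proof -
  let ?comb = "\<lambda>l j. \<Sum>i<g. l i * A $$ (i, j)"
  have "\<exists>l. \<forall>j<q. ?comb l j = B $$ (k, j)" if k: "k < h" for k
  proof (rule ccontr)
    assume neg: "\<nexists>l. \<forall>j<q. ?comb l j = B $$ (k, j)"
    have "\<exists>X. (\<forall>u\<in>range ?comb. (\<Sum>j<q. u j \<bullet>\<^sub>D X j) = 0) \<and>
        (\<Sum>j<q. B $$ (k, j) \<bullet>\<^sub>D X j) \<noteq> 0"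
    proof (rule separating_solution)
      show "(\<lambda>j. 0) \<in> range ?comb" by (rule range_eqI[of _ _ "\<lambda>i. 0"]) simp
      fix r u v assume "u \<in> range ?comb" "v \<in> range ?comb"
      then obtain l m where "u = ?comb l" "v = ?comb m" by blast
      then show "(\<lambda>j. u j + r * v j) \<in> range ?comb"
        by (intro range_eqI[of _ _ "\<lambda>i. l i + r * m i"])
          (simp add: sum.distrib sum_distrib_left algebra_simps)
    next
      show "\<exists>j<q. u j \<noteq> B $$ (k, j)" if "u \<in> range ?comb" for u
        using neg that by blast
    qed
    then obtain X where X: "\<forall>u\<in>range ?comb. (\<Sum>j<q. u j \<bullet>\<^sub>D X j) = 0"
      and XB: "(\<Sum>j<q. B $$ (k, j) \<bullet>\<^sub>D X j) \<noteq> 0"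
      by (elim exE conjE)
    have "mat_act A X i = 0" if "i < g" for i
    proof -
      have "(\<lambda>j. A $$ (i, j)) = ?comb (\<lambda>i'. if i' = i then 1 else 0)"
        using that by (simp add: if_distrib[of "\<lambda>x. x * _"] cong: if_cong)
      from bspec[OF X, OF range_eqI[where f = ?comb, OF this]] A show ?thesis by (simp add: mat_act_def)
    qed
    moreover have act: "mat_act C (component (traj_of q X)) = mat_act C X" if "dim_col C = q" for C
      using that by (intro mat_act_cong) (simp add: component_traj_of)
    ultimately have "traj_of q X \<in> ker_diff A"
      using A by (simp add: ker_diff_iff traj_of_smooth)
    with sub have "traj_of q X \<in> ker_diff B" by blast
    then show False
      using B k XB act[of B] by (simp add: ker_diff_iff) (simp add: mat_act_def)
  qed
  then obtain l where l: "\<And>k j. k < h \<Longrightarrow> j < q \<Longrightarrow> ?comb (l k) j = B $$ (k, j)" by metis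
  show thesis
  proof (rule that)
    show "mat h g (\<lambda>(k, i). l k i) \<in> carrier_mat h g" by simp
    show "B = mat h g (\<lambda>(k, i). l k i) * A"
      by (rule eq_matI) (use A B l in \<open>auto simp: scalar_prod_def atLeast0LessThan\<close>)
  qed
qed

section \<open>Rank and linear independence of rows over a field\<close>

context vec_space
begin

text \<open>
  \<open>B\<close> collects a maximal independent set of columns of \<open>A\<close>, the columns of \<open>E\<close> are the coordinates of
  all columns in terms of these, and \<open>Z\<close> selects them from \<open>A\<close>.
\<close>

lemma column_rank_factorization:
  assumes A: "A \<in> carrier_mat n m"
  obtains B E Z where "B \<in> carrier_mat n (rank A)" "E \<in> carrier_mat (rank A) m"
    "Z \<in> carrier_mat m (rank A)" "A = B * E" "B = A * Z"
    "\<And>v. v \<in> carrier_vec (rank A) \<Longrightarrow> B *\<^sub>v v = 0\<^sub>v n \<Longrightarrow> v = 0\<^sub>v (rank A)"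
proof -
  have cols: "set (cols A) \<subseteq> carrier_vec n" using A cols_dim by blast
  obtain S where S: "maximal S (\<lambda>T. T \<subseteq> set (cols A) \<and> lin_indpt T)" "finite S"
    using maximal_exists_superset[of "set (cols A)" "\<lambda>T. T \<subseteq> set (cols A) \<and> lin_indpt T" "{}"]
    by (auto simp: finite_lin_indpt2)
  then have S_cols: "S \<subseteq> set (cols A)" and indpt: "lin_indpt S" by (auto simp: maximal_def)
  with cols have S_carrier: "S \<subseteq> carrier_vec n" by blast
  obtain xs where xs: "set xs = S" "distinct xs"
    using \<open>finite S\<close> finite_distinct_list by blast
  let ?r = "rank A"
  have len: "length xs = ?r"
    using rank_card_indpt[OF A S(1)] xs distinct_card by metis
  define B where "B = mat_of_cols n xs"
  have B: "B \<in> carrier_mat n ?r" and cols_B: "cols B = xs"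
    using xs S_carrier len by (auto simp: B_def)
  have "\<exists>e\<in>carrier_vec ?r. col A j = B *\<^sub>v e" if "j < m" for j
  proof -
    have "col A j \<in> span S"
    proof (cases "col A j \<in> S")
      case True
      then show ?thesis using in_own_span[OF S_carrier] by blast
    next
      case False
      have j: "col A j \<in> set (cols A)" using A that by (auto simp: cols_def)
      have "\<not> lin_indpt (insert (col A j) S)"
        using S(1) S_cols j False unfolding maximal_def by blast
      then show ?thesis
        using lin_dep_iff_in_span[OF S_carrier indpt _ False] j cols by auto
    qed
    then obtain a where "col A j = lincomb a S"
      using finite_span[OF \<open>finite S\<close> S_carrier] by auto
    also have "\<dots> = B *\<^sub>v Matrix.vec ?r (\<lambda>i. a (col B i))"
      using mat_mult_eq_lincomb[OF B] cols_B xs by simp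
    finally show ?thesis by auto
  qed
  then obtain e where e: "\<And>j. j < m \<Longrightarrow> e j \<in> carrier_vec ?r" "\<And>j. j < m \<Longrightarrow> col A j = B *\<^sub>v e j"
    by metis
  define E where "E = mat_of_cols ?r (map e [0..<m])"
  have E: "E \<in> carrier_mat ?r m" using mat_of_cols_carrier(1)[of ?r "map e [0..<m]"] by (simp add: E_def)
  have "\<exists>j<m. xs ! i = col A j" if "i < ?r" for i
  proof -
    have "xs ! i \<in> S" using that len nth_mem[of i xs] xs(1) by simp
    then have "xs ! i \<in> set (cols A)" using S_cols by (rule subsetD[rotated])
    then obtain l where "l < length (cols A)" "xs ! i = cols A ! l" by (metis in_set_conv_nth)
    then show ?thesis using A by auto
  qed
  then obtain c where c: "\<And>i. i < ?r \<Longrightarrow> c i < m" "\<And>i. i < ?r \<Longrightarrow> xs ! i = col A (c i)" by metis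
  define Z :: "'a mat" where "Z = mat_of_cols m (map (\<lambda>i. unit_vec m (c i)) [0..<?r])"
  have Z: "Z \<in> carrier_mat m ?r"
    using mat_of_cols_carrier(1)[of m "map (\<lambda>i. unit_vec m (c i)) [0..<?r]"] by (simp add: Z_def)
  show thesis
  proof (rule that[OF B E Z])
    show "A = B * E"
    proof (rule mat_col_eqI)
      show "col A j = col (B * E) j" if "j < dim_col (B * E)" for j
      proof -
        from that E have j: "j < m" by simp
        then have "col E j = e j" using e(1) by (simp add: E_def)
        then show ?thesis using e(2)[OF j] col_mult2[OF B E j] by (simp only:)
      qed
    qed (use A B E in auto)
    show "B = A * Z"
    proof (rule mat_col_eqI)
      show "col B j = col (A * Z) j" if "j < dim_col (A * Z)" for j
      proof -
        from that Z have j: "j < ?r" by simp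
        then have "col Z j = unit_vec m (c j)" by (simp add: Z_def)
        then have "col (A * Z) j = A *\<^sub>v unit_vec m (c j)"
          using col_mult2[OF A Z j] by (simp only:)
        also have "\<dots> = col A (c j)" using A c(1)[OF j] by (intro eq_vecI) auto
        also have "\<dots> = col B j" using B j len c(2)[OF j] by (metis carrier_matD(2) cols_B cols_nth)
        finally show ?thesis ..
      qed
    qed (use A B Z in auto)
    show "v = 0\<^sub>v ?r" if "v \<in> carrier_vec ?r" "B *\<^sub>v v = 0\<^sub>v n" for v
      using lin_depI[OF B that(1) _ that(2)] indpt cols_B xs by auto
  qed
qed

end

lemma mult_mat_zero_vec:
  fixes A :: "'a::semiring_0 mat"
  assumes "A \<in> carrier_mat n m"
  shows "A *\<^sub>v 0\<^sub>v m = 0\<^sub>v n"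
  using assms by (intro eq_vecI) auto

text \<open>
  Padding with zero rows gives a square matrix with determinant zero.
\<close>

lemma exists_nonzero_kernel_vector:
  fixes B :: "'a::field mat"
  assumes B: "B \<in> carrier_mat n m" and "n < m"
  obtains v where "v \<in> carrier_vec m" "v \<noteq> 0\<^sub>v m" "B *\<^sub>v v = 0\<^sub>v n"
proof -
  define B' where "B' = mat m m (\<lambda>(i, j). if i < n then B $$ (i, j) else 0)"
  have B': "B' \<in> carrier_mat m m" by (simp add: B'_def)
  have "B' = mat\<^sub>r m m (\<lambda>i. if i = n then 0\<^sub>v m else row B' i)"
    using \<open>n < m\<close> by (intro eq_matI) (auto simp: B'_def)
  then have "det B' = 0"
    by (metis (no_types, lifting) det_row_0[OF \<open>n < m\<close>, of "row B'"] B' Pi_I row_carrier_vec atLeastLessThan_iff)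
  then obtain v where v: "v \<in> carrier_vec m" "v \<noteq> 0\<^sub>v m" "B' *\<^sub>v v = 0\<^sub>v m"
    using det_0_iff_vec_prod_zero_field[OF B'] by blast
  have "(B *\<^sub>v v) $ i = 0" if "i < n" for i
  proof -
    have "(B *\<^sub>v v) $ i = (B' *\<^sub>v v) $ i"
      using that B \<open>n < m\<close> v(1) by (simp add: B'_def scalar_prod_def)
    then show ?thesis using v(3) that \<open>n < m\<close> by simp
  qed
  then have "B *\<^sub>v v = 0\<^sub>v n" using B by (intro eq_vecI) auto
  with v show thesis using that by blast
qed

text \<open>
  The coefficient matrix \<open>L\<close> may have any number of rows: then independence can be applied
  to matrix identities directly.
\<close>

definition rows_indpt :: "'a::comm_ring_1 mat \<Rightarrow> bool" where
  "rows_indpt C \<longleftrightarrow> (\<forall>j. \<forall>L \<in> carrier_mat j (dim_row C). L * C = 0\<^sub>m j (dim_col C) \<longrightarrow> L = 0\<^sub>m j (dim_row C))"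

lemma rows_indptD:
  assumes "rows_indpt C" "C \<in> carrier_mat k c" "L \<in> carrier_mat j k" "L * C = 0\<^sub>m j c"
  shows "L = 0\<^sub>m j k"
  using assms unfolding rows_indpt_def by auto

lemma right_inverse_imp_rows_indpt:
  assumes C: "C \<in> carrier_mat k c" and Z: "Z \<in> carrier_mat c k" "C * Z = 1\<^sub>m k"
  shows "rows_indpt C"
  unfolding rows_indpt_def
proof (intro allI ballI impI)
  fix j L assume "L \<in> carrier_mat j (dim_row C)" "L * C = 0\<^sub>m j (dim_col C)"
  then have L: "L \<in> carrier_mat j k" "L * C = 0\<^sub>m j c" using C by auto
  have "(L * C) * Z = L * (C * Z)" by (rule assoc_mult_mat[OF L(1) C Z(1)])
  then show "L = 0\<^sub>m j (dim_row C)" using L Z C by simp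
qed

text \<open>
  Take \<open>C = B E\<close> with inner dimension the rank. If that were less than the number of rows, some
  nonzero row would annihilate \<open>B\<close> and hence \<open>C\<close>. So \<open>B\<close> is square with trivial kernel, and inverting it
  gives the right inverse.
\<close>

lemma rows_indpt_right_inverse:
  fixes C :: "'a::field mat"
  assumes C: "C \<in> carrier_mat k c" and indpt: "rows_indpt C"
  obtains Z where "Z \<in> carrier_mat c k" "C * Z = 1\<^sub>m k" "vec_space.rank k C = k"
proof -
  interpret vec_space "TYPE('a)" k .
  obtain B E Z where B: "B \<in> carrier_mat k (rank C)" and E: "E \<in> carrier_mat (rank C) c"
    and Z: "Z \<in> carrier_mat c (rank C)" and CBE: "C = B * E" and BCZ: "B = C * Z"
    and inj: "\<And>v. v \<in> carrier_vec (rank C) \<Longrightarrow> B *\<^sub>v v = 0\<^sub>v k \<Longrightarrow> v = 0\<^sub>v (rank C)"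
    using column_rank_factorization[OF C] by metis
  have "\<not> k < rank C"
    using exists_nonzero_kernel_vector[OF B] inj by metis
  moreover have "\<not> rank C < k"
  proof
    assume "rank C < k"
    then obtain v where v: "v \<in> carrier_vec k" "v \<noteq> 0\<^sub>v k" "B\<^sup>T *\<^sub>v v = 0\<^sub>v (rank C)"
      using exists_nonzero_kernel_vector[of "B\<^sup>T"] B by auto
    let ?L = "mat_of_row v"
    have L: "?L \<in> carrier_mat 1 k" using v(1) by (rule mat_of_row_carrier)
    have "?L * B = 0\<^sub>m 1 (rank C)"
    proof (rule eq_matI)
      fix i j assume "i < dim_row (0\<^sub>m 1 (rank C))" "j < dim_col (0\<^sub>m 1 (rank C))"
      moreover from this have "(B\<^sup>T *\<^sub>v v) $ j = 0" using v(3) by simp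
      ultimately show "(?L * B) $$ (i, j) = 0\<^sub>m 1 (rank C) $$ (i, j)"
        using B v(1) comm_scalar_prod[of v k "col B j"] by simp
    qed (use B in auto)
    then have "?L * C = 0\<^sub>m 1 c"
      using B E L by (simp add: CBE flip: assoc_mult_mat[OF L B E])
    then have "?L = 0\<^sub>m 1 k" using rows_indptD[OF indpt C L] by blast
    then have "row ?L 0 = row (0\<^sub>m 1 k) 0" by (rule arg_cong)
    then have "v = 0\<^sub>v k" by (simp only: row_mat_of_row row_zero[of 0 "1::nat"] zero_less_one)
    with v(2) show False by blast
  qed
  ultimately have r: "rank C = k" by simp
  have B': "B \<in> carrier_mat k k" using B r by simp
  have "det B \<noteq> 0"
    using det_0_iff_vec_prod_zero_field[OF B'] inj r by auto
  then obtain G where G: "G \<in> carrier_mat k k" "B * G = 1\<^sub>m k"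
    using det_non_zero_imp_unit[OF B', of undefined] by (auto simp: Units_def ring_mat_def)
  have Z': "Z \<in> carrier_mat c k" using Z r by simp
  have "C * (Z * G) = 1\<^sub>m k"
    using G by (simp add: BCZ flip: assoc_mult_mat[OF C Z' G(1)])
  then show thesis using that[of "Z * G"] Z' G(1) r by auto
qed

text \<open>
  The left inverse \<open>G\<close> gives \<open>E = G A\<close>, so \<open>A\<close> and \<open>E\<close> have the same row space and the rows of \<open>E\<close> are
  a basis of it. \<open>G\<close> exists because the columns of \<open>B\<close> are independent: it is the transpose of a
  right inverse of the transpose of \<open>B\<close>.
\<close>

lemma rank_factorization:
  fixes A :: "'a::field mat"
  assumes A: "A \<in> carrier_mat n m" and r: "vec_space.rank n A = r"
  obtains B E G where "B \<in> carrier_mat n r" "E \<in> carrier_mat r m" "G \<in> carrier_mat r n"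
    "A = B * E" "G * B = 1\<^sub>m r" "rows_indpt E"
proof -
  interpret vec_space "TYPE('a)" n .
  obtain B E Z where B: "B \<in> carrier_mat n r" and E: "E \<in> carrier_mat r m"
    and Z: "Z \<in> carrier_mat m r" and ABE: "A = B * E" and BAZ: "B = A * Z"
    and inj: "\<And>v. v \<in> carrier_vec r \<Longrightarrow> B *\<^sub>v v = 0\<^sub>v n \<Longrightarrow> v = 0\<^sub>v r"
    using column_rank_factorization[OF A] r by metis
  have "rows_indpt (B\<^sup>T)"
    unfolding rows_indpt_def
  proof (intro allI ballI impI)
    fix j L assume "L \<in> carrier_mat j (dim_row B\<^sup>T)" and LB: "L * B\<^sup>T = 0\<^sub>m j (dim_col B\<^sup>T)"
    then have L: "L \<in> carrier_mat j r" using B by simp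
    have "row L i = 0\<^sub>v r" if "i < j" for i
    proof (rule inj)
      show "row L i \<in> carrier_vec r" using L that by auto
      show "B *\<^sub>v row L i = 0\<^sub>v n"
      proof (rule eq_vecI)
        fix l assume l: "l < dim_vec (0\<^sub>v n :: 'a vec)"
        then have "(L * B\<^sup>T) $$ (i, l) = 0" using LB B that by simp
        then show "(B *\<^sub>v row L i) $ l = 0\<^sub>v n $ l"
          using L B l that comm_scalar_prod[of "row L i" r "row B l"] by auto
      qed (use B in auto)
    qed
    then show "L = 0\<^sub>m j (dim_row B\<^sup>T)"
      using L B by (intro eq_rowI) auto
  qed
  then obtain H where H: "H \<in> carrier_mat n r" "B\<^sup>T * H = 1\<^sub>m r"
    using rows_indpt_right_inverse[of "B\<^sup>T" r n] B by auto
  then have G: "H\<^sup>T \<in> carrier_mat r n" "H\<^sup>T * B = 1\<^sub>m r"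
    using transpose_mult[of "B\<^sup>T" r n H r] B by auto
  \<comment> \<open>\<open>Z\<close> selects the columns of \<open>B\<close> from \<open>A\<close>, so it is a right inverse of the coordinate matrix.\<close>
  have "E * Z = (H\<^sup>T * B) * (E * Z)" using G E Z by simp
  also have "\<dots> = H\<^sup>T * (B * (E * Z))" using G B E Z by (intro assoc_mult_mat) auto
  also have "B * (E * Z) = B" using BAZ ABE assoc_mult_mat[OF B E Z] by simp
  finally have "E * Z = 1\<^sub>m r" using G by simp
  then have "rows_indpt E" using right_inverse_imp_rows_indpt[OF E Z] by blast
  with that B E G ABE show thesis by blast
qed

lemma rows_indpt_iff_rank:
  fixes C :: "'a::field mat"
  assumes C: "C \<in> carrier_mat k c"
  shows "rows_indpt C \<longleftrightarrow> vec_space.rank k C = k"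
proof
  assume "rows_indpt C"
  then show "vec_space.rank k C = k" using rows_indpt_right_inverse[OF C] by metis
next
  assume "vec_space.rank k C = k"
  then obtain B E G where B: "B \<in> carrier_mat k k" and E: "E \<in> carrier_mat k c"
    and G: "G \<in> carrier_mat k k" and CBE: "C = B * E" and GB: "G * B = 1\<^sub>m k" and ind: "rows_indpt E"
    using rank_factorization[OF C] by metis
  obtain Z where Z: "Z \<in> carrier_mat c k" "E * Z = 1\<^sub>m k"
    using rows_indpt_right_inverse[OF E ind] by metis
  have "C * (Z * G) = B * (E * (Z * G))" using B E Z G unfolding CBE by (intro assoc_mult_mat) auto
  also have "E * (Z * G) = (E * Z) * G" by (rule assoc_mult_mat[OF E Z(1) G, symmetric])
  also have "B * \<dots> = 1\<^sub>m k"
    using Z(2) G mat_mult_left_right_inverse[OF G B GB] by simp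
  finally show "rows_indpt C" using right_inverse_imp_rows_indpt[OF C _, of "Z * G"] Z G by auto
qed

text \<open>
  A rank larger than the inner dimension \<open>r\<close> of a factorization would give more than \<open>r\<close>
  independent columns that all factor through an \<open>r\<close>-dimensional space.
\<close>

lemma rank_mult_le:
  fixes P :: "'a::field mat"
  assumes P: "P \<in> carrier_mat n' n" and A: "A \<in> carrier_mat n m"
  shows "vec_space.rank n' (P * A) \<le> vec_space.rank n A"
proof (rule ccontr)
  define r s where "r = vec_space.rank n A" and "s = vec_space.rank n' (P * A)"
  assume "\<not> vec_space.rank n' (P * A) \<le> vec_space.rank n A"
  then have "r < s" by (simp add: r_def s_def)
  obtain B E where B: "B \<in> carrier_mat n r" and E: "E \<in> carrier_mat r m" and ABE: "A = B * E"
    using rank_factorization[OF A r_def[symmetric]] by metis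
  obtain B' Z where B': "B' \<in> carrier_mat n' s" and Z: "Z \<in> carrier_mat m s" and BZ: "B' = P * A * Z"
    and inj: "\<And>v. v \<in> carrier_vec s \<Longrightarrow> B' *\<^sub>v v = 0\<^sub>v n' \<Longrightarrow> v = 0\<^sub>v s"
    using vec_space.column_rank_factorization[of "P * A" n' m] P A unfolding s_def by (metis mult_carrier_mat)
  obtain v where v: "v \<in> carrier_vec s" "v \<noteq> 0\<^sub>v s" "(E * Z) *\<^sub>v v = 0\<^sub>v r"
    using exists_nonzero_kernel_vector[of "E * Z" r s] E Z \<open>r < s\<close> by auto
  have "B' = (P * B) * (E * Z)"
  proof -
    have "P * (B * E) = (P * B) * E" by (rule assoc_mult_mat[OF P B E, symmetric])
    moreover have "(P * B) * E * Z = (P * B) * (E * Z)" using P B by (intro assoc_mult_mat[OF _ E Z]) auto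
    ultimately show ?thesis by (simp add: BZ ABE)
  qed
  then have "B' *\<^sub>v v = (P * B) *\<^sub>v ((E * Z) *\<^sub>v v)"
    using P B E Z v(1) by (simp only:) (intro assoc_mult_mat_vec[of _ n' r _ s], auto)
  moreover have "(P * B) *\<^sub>v 0\<^sub>v r = 0\<^sub>v n'" using P B by (intro mult_mat_zero_vec) auto
  ultimately have "B' *\<^sub>v v = 0\<^sub>v n'" using v(3) by simp
  then show False using inj v by blast
qed

text \<open>
  The rows of \<open>Y\<close> are independent modulo the row space (row module, over a ring) of \<open>X\<close>.
\<close>

definition rows_indpt_mod :: "'a::comm_ring_1 mat \<Rightarrow> 'a mat \<Rightarrow> bool" where
  "rows_indpt_mod X Y \<longleftrightarrow> (\<forall>j. \<forall>L \<in> carrier_mat j (dim_row X). \<forall>N \<in> carrier_mat j (dim_row Y).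
     L * X = N * Y \<longrightarrow> N = 0\<^sub>m j (dim_row Y))"

lemma rows_indpt_modD:
  assumes "rows_indpt_mod X Y" "X \<in> carrier_mat g n" "Y \<in> carrier_mat k n"
    "L \<in> carrier_mat j g" "N \<in> carrier_mat j k" "L * X = N * Y"
  shows "N = 0\<^sub>m j k"
  using assms unfolding rows_indpt_mod_def by auto

lemma rows_indpt_mod_imp_rows_indpt:
  assumes mod: "rows_indpt_mod X Y" and X: "X \<in> carrier_mat g n" and Y: "Y \<in> carrier_mat k n"
  shows "rows_indpt Y"
  unfolding rows_indpt_def
proof (intro allI ballI impI)
  fix j N assume N: "N \<in> carrier_mat j (dim_row Y)" and eq: "N * Y = 0\<^sub>m j (dim_col Y)"
  then have "0\<^sub>m j g * X = N * Y" using X Y by simp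
  then show "N = 0\<^sub>m j (dim_row Y)"
    using rows_indpt_modD[OF mod X Y zero_carrier_mat] N Y by simp
qed

text \<open>
  Lets statements about independence be read off from those about relative independence.
\<close>

lemma rows_indpt_iff_mod_empty:
  assumes C: "C \<in> carrier_mat k c"
  shows "rows_indpt C \<longleftrightarrow> rows_indpt_mod (0\<^sub>m 0 c) C"
proof -
  have 0: "L * 0\<^sub>m 0 c = 0\<^sub>m j c" if "L \<in> carrier_mat j 0" for L :: "'a mat" and j
    using that by (intro eq_matI) (auto simp: scalar_prod_def)
  show ?thesis
  proof
    assume indpt: "rows_indpt C"
    show "rows_indpt_mod (0\<^sub>m 0 c) C"
      unfolding rows_indpt_mod_def
    proof (intro allI ballI impI)
      fix j L N assume "L \<in> carrier_mat j (dim_row (0\<^sub>m 0 c :: 'a mat))" and N: "N \<in> carrier_mat j (dim_row C)"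
        and "L * 0\<^sub>m 0 c = N * C"
      then have "N * C = 0\<^sub>m j c" using 0[of L j] by simp
      with N show "N = 0\<^sub>m j (dim_row C)" using rows_indptD[OF indpt C] C by simp
    qed
  next
    assume mod: "rows_indpt_mod (0\<^sub>m 0 c) C"
    show "rows_indpt C"
      unfolding rows_indpt_def
    proof (intro allI ballI impI)
      fix j N assume N: "N \<in> carrier_mat j (dim_row C)" and "N * C = 0\<^sub>m j (dim_col C)"
      then have "0\<^sub>m j 0 * 0\<^sub>m 0 c = N * C" using 0[of "0\<^sub>m j 0" j] C by simp
      with N show "N = 0\<^sub>m j (dim_row C)"
        using rows_indpt_modD[OF mod zero_carrier_mat C, of "0\<^sub>m j 0" j N] C by simp
    qed
  qed
qed

text \<open>
  The blocks without rows match the form in which the plant matrix \<open>[R M]\<close> occurs in the definition of a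
  regular controller.
\<close>

abbreviation append_cols :: "'a::zero mat \<Rightarrow> 'a mat \<Rightarrow> 'a mat" (infixr "@\<^sub>c" 65) where
  "A @\<^sub>c B \<equiv> four_block_mat A B (0\<^sub>m 0 (dim_col A)) (0\<^sub>m 0 (dim_col B))"

lemma carrier_append_cols:
  assumes "A \<in> carrier_mat g w" "B \<in> carrier_mat g c"
  shows "A @\<^sub>c B \<in> carrier_mat g (w + c)"
  using assms by auto

lemma append_cols_mult_append_rows:
  fixes L :: "'a::comm_ring_1 mat"
  assumes L: "L \<in> carrier_mat j r" and N: "N \<in> carrier_mat j k"
    and X: "X \<in> carrier_mat r n" and Y: "Y \<in> carrier_mat k n"
  shows "(L @\<^sub>c N) * (X @\<^sub>r Y) = L * X + N * Y"
proof -
  have "(L @\<^sub>c N) * (X @\<^sub>r Y) = four_block_mat (L * X + N * Y) (L * 0\<^sub>m r 0 + N * 0\<^sub>m k 0)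
      (0\<^sub>m 0 r * X + 0\<^sub>m 0 k * Y) (0\<^sub>m 0 r * 0\<^sub>m r 0 + 0\<^sub>m 0 k * 0\<^sub>m k 0)"
    unfolding append_rows_def using assms by (subst mult_four_block_mat) auto
  also have "\<dots> = L * X + N * Y"
    using assms by (intro eq_matI) auto
  finally show ?thesis .
qed

lemma split_cols:
  assumes "U \<in> carrier_mat j (r + k)"
  obtains L N where "L \<in> carrier_mat j r" "N \<in> carrier_mat j k" "U = L @\<^sub>c N"
proof (rule that)
  show "U = mat j r (\<lambda>(i, l). U $$ (i, l)) @\<^sub>c mat j k (\<lambda>(i, l). U $$ (i, r + l))"
    using assms by (intro eq_matI) auto
qed auto

lemma append_cols_eq_iff:
  assumes "A \<in> carrier_mat g w" "A' \<in> carrier_mat g w" "B \<in> carrier_mat g c" "B' \<in> carrier_mat g c"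
  shows "A @\<^sub>c B = A' @\<^sub>c B' \<longleftrightarrow> A = A' \<and> B = B'"
proof
  assume eq: "A @\<^sub>c B = A' @\<^sub>c B'"
  have "A $$ (i, j) = A' $$ (i, j)" if "i < g" "j < w" for i j
    using arg_cong[OF eq, of "\<lambda>U. U $$ (i, j)"] that assms by simp
  moreover have "B $$ (i, j) = B' $$ (i, j)" if "i < g" "j < c" for i j
    using arg_cong[OF eq, of "\<lambda>U. U $$ (i, w + j)"] that assms by simp
  ultimately show "A = A' \<and> B = B'"
    using assms by (intro conjI eq_matI) auto
qed (use assms in auto)

lemma mult_append_cols:
  fixes L :: "'a::comm_ring_1 mat"
  assumes L: "L \<in> carrier_mat j g" and A: "A \<in> carrier_mat g w" and B: "B \<in> carrier_mat g c"
  shows "L * (A @\<^sub>c B) = (L * A) @\<^sub>c (L * B)"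
proof (rule eq_matI)
  fix i l assume "i < dim_row ((L * A) @\<^sub>c (L * B))" "l < dim_col ((L * A) @\<^sub>c (L * B))"
  then show "(L * (A @\<^sub>c B)) $$ (i, l) = ((L * A) @\<^sub>c (L * B)) $$ (i, l)"
    using assms by (auto simp: scalar_prod_def intro!: sum.cong)
qed (use assms in auto)

lemma uminus_eq_zero_mat:
  fixes N :: "'a::group_add mat"
  assumes "- N = 0\<^sub>m j k"
  shows "N = 0\<^sub>m j k"
proof -
  have "N = - (- N)" by (intro eq_matI) auto
  also have "\<dots> = 0\<^sub>m j k" unfolding assms by (intro eq_matI) auto
  finally show ?thesis .
qed

lemma rows_indpt_append_iff:
  assumes X: "X \<in> carrier_mat r n" and Y: "Y \<in> carrier_mat k n"
  shows "rows_indpt (X @\<^sub>r Y) \<longleftrightarrow> rows_indpt X \<and> rows_indpt_mod X Y"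
proof (intro iffI conjI)
  have XY: "X @\<^sub>r Y \<in> carrier_mat (r + k) n" using X Y by simp
  assume indpt: "rows_indpt (X @\<^sub>r Y)"
  have both: "L = 0\<^sub>m j r \<and> N = 0\<^sub>m j k"
    if L: "L \<in> carrier_mat j r" and N: "N \<in> carrier_mat j k" and eq: "L * X = N * Y" for j L N
  proof -
    have "(L @\<^sub>c (- N)) * (X @\<^sub>r Y) = L * X + (- N) * Y"
      using L N X Y by (intro append_cols_mult_append_rows) auto
    also have "\<dots> = N * Y + - (N * Y)"
      using N Y by (simp add: eq uminus_mult_left_mat[of N Y])
    also have "\<dots> = 0\<^sub>m j n"
      using N Y by (intro eq_matI) (simp_all del: index_mult_mat(1))
    finally have "L @\<^sub>c (- N) = 0\<^sub>m j (r + k)"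
      using rows_indptD[OF indpt XY carrier_append_cols[OF L, of "- N"]] N by auto
    also have "\<dots> = 0\<^sub>m j r @\<^sub>c 0\<^sub>m j k"
      by (intro eq_matI) auto
    finally have "L = 0\<^sub>m j r" "- N = 0\<^sub>m j k"
      using append_cols_eq_iff[of L j r "0\<^sub>m j r" "- N" k "0\<^sub>m j k"] L N by auto
    then show ?thesis using uminus_eq_zero_mat by blast
  qed
  show "rows_indpt X"
    unfolding rows_indpt_def using both[OF _ zero_carrier_mat] X Y by auto
  show "rows_indpt_mod X Y"
    unfolding rows_indpt_mod_def using both X Y by auto
next
  assume indpt: "rows_indpt X \<and> rows_indpt_mod X Y"
  show "rows_indpt (X @\<^sub>r Y)"
    unfolding rows_indpt_def
  proof (intro allI ballI impI)
    fix j U assume "U \<in> carrier_mat j (dim_row (X @\<^sub>r Y))"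
      and UXY: "U * (X @\<^sub>r Y) = 0\<^sub>m j (dim_col (X @\<^sub>r Y))"
    then have "U \<in> carrier_mat j (r + k)" using X Y by (simp add: append_rows_def)
    then obtain L N where L: "L \<in> carrier_mat j r" and N: "N \<in> carrier_mat j k" and U: "U = L @\<^sub>c N"
      by (rule split_cols)
    have sum: "L * X + N * Y = 0\<^sub>m j n"
      using UXY X Y append_cols_mult_append_rows[OF L N X Y] by (simp add: U append_rows_def)
    have LX: "L * X \<in> carrier_mat j n" and NY: "N * Y \<in> carrier_mat j n" using L N X Y by auto
    have "L * X = (- N) * Y"
    proof (rule eq_matI)
      fix a b assume ab: "a < dim_row (- N * Y)" "b < dim_col (- N * Y)"
      then have "(L * X) $$ (a, b) + (N * Y) $$ (a, b) = 0"
        using arg_cong[OF sum, of "\<lambda>A. A $$ (a, b)"] LX NY N Y by auto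
      then show "(L * X) $$ (a, b) = (- N * Y) $$ (a, b)"
        using ab N Y L X by (simp add: eq_neg_iff_add_eq_0 uminus_mult_left_mat[of N Y] )
    qed (use L N X Y in auto)
    then have "- N = 0\<^sub>m j k"
      using rows_indpt_modD[of X Y r n k L j "- N"] indpt X Y L N by auto
    then have N0: "N = 0\<^sub>m j k" by (rule uminus_eq_zero_mat)
    then have "L * X = 0\<^sub>m j n" using sum LX Y by (simp add: right_add_zero_mat)
    then have "L = 0\<^sub>m j r" using rows_indptD[OF _ X L] indpt by blast
    then show "U = 0\<^sub>m j (dim_row (X @\<^sub>r Y))"
      using N0 X Y by (intro eq_matI) (auto simp: U append_rows_def)
  qed
qed

text \<open>
  Replacing \<open>X\<close> by a row basis \<open>E\<close> of its row space preserves the rank of the stacked matrix,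
  because both passages are left multiplications. The stacked matrix then has exactly
  \<open>rank X + k\<close> rows, so the rank condition says that all its rows are independent.
\<close>

lemma rank_append_rows_iff:
  fixes X :: "'a::field mat"
  assumes X: "X \<in> carrier_mat g n" and Y: "Y \<in> carrier_mat k n"
  shows "vec_space.rank (g + k) (X @\<^sub>r Y) = vec_space.rank g X + k \<longleftrightarrow> rows_indpt_mod X Y"
proof -
  define r where "r = vec_space.rank g X"
  obtain B E G where B: "B \<in> carrier_mat g r" and E: "E \<in> carrier_mat r n" and G: "G \<in> carrier_mat r g"
    and XBE: "X = B * E" and GB: "G * B = 1\<^sub>m r" and indpt: "rows_indpt E"
    using rank_factorization[OF X r_def[symmetric]] by metis
  have "G * X = (G * B) * E" unfolding XBE by (rule assoc_mult_mat[OF G B E, symmetric])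
  with E have GX: "G * X = E" by (simp add: GB)
  have XY: "X @\<^sub>r Y \<in> carrier_mat (g + k) n" and EY: "E @\<^sub>r Y \<in> carrier_mat (r + k) n"
    using X Y E by auto
  have diag: "four_block_mat P (0\<^sub>m a k) (0\<^sub>m k b) (1\<^sub>m k) * (U @\<^sub>r Y) = (P * U) @\<^sub>r Y"
    if "P \<in> carrier_mat a b" "U \<in> carrier_mat b n" for P U :: "'a mat" and a b
    unfolding append_rows_def using that Y by (subst mult_four_block_mat) (auto intro!: cong_four_block_mat)
  have "vec_space.rank (g + k) (X @\<^sub>r Y) = vec_space.rank (r + k) (E @\<^sub>r Y)"
  proof (rule antisym)
    show "vec_space.rank (g + k) (X @\<^sub>r Y) \<le> vec_space.rank (r + k) (E @\<^sub>r Y)"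
      using rank_mult_le[OF _ EY, of "four_block_mat B (0\<^sub>m g k) (0\<^sub>m k r) (1\<^sub>m k)" "g + k"]
        diag[OF B E] B by (simp add: XBE)
    show "vec_space.rank (r + k) (E @\<^sub>r Y) \<le> vec_space.rank (g + k) (X @\<^sub>r Y)"
      using rank_mult_le[OF _ XY, of "four_block_mat G (0\<^sub>m r k) (0\<^sub>m k g) (1\<^sub>m k)" "r + k"]
        diag[OF G X] G by (simp add: GX)
  qed
  then have "vec_space.rank (g + k) (X @\<^sub>r Y) = r + k \<longleftrightarrow> rows_indpt (E @\<^sub>r Y)"
    using rows_indpt_iff_rank[OF EY] by simp
  also have "\<dots> \<longleftrightarrow> rows_indpt_mod E Y"
    using rows_indpt_append_iff[OF E Y] indpt by simp
  also have "\<dots> \<longleftrightarrow> rows_indpt_mod X Y"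
  proof
    assume mod: "rows_indpt_mod E Y"
    show "rows_indpt_mod X Y"
      unfolding rows_indpt_mod_def
    proof (intro allI ballI impI)
      fix j L N assume L': "L \<in> carrier_mat j (dim_row X)" and N': "N \<in> carrier_mat j (dim_row Y)" and eq: "L * X = N * Y"
      have L: "L \<in> carrier_mat j g" and N: "N \<in> carrier_mat j k" using L' N' X Y by auto
      have "(L * B) * E = N * Y"
        using eq unfolding XBE by (simp only: assoc_mult_mat[OF L B E])
      then show "N = 0\<^sub>m j (dim_row Y)"
        using rows_indpt_modD[OF mod E Y _ N, of "L * B"] L B Y by auto
    qed
  next
    assume mod: "rows_indpt_mod X Y"
    show "rows_indpt_mod E Y"
      unfolding rows_indpt_mod_def
    proof (intro allI ballI impI)
      fix j L N assume L': "L \<in> carrier_mat j (dim_row E)" and N': "N \<in> carrier_mat j (dim_row Y)" and eq: "L * E = N * Y"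
      have L: "L \<in> carrier_mat j r" and N: "N \<in> carrier_mat j k" using L' N' E Y by auto
      have "(L * G) * X = N * Y"
        using eq by (simp only: assoc_mult_mat[OF L G X] GX)
      then show "N = 0\<^sub>m j (dim_row Y)"
        using rows_indpt_modD[OF mod X Y _ N, of "L * G"] L G Y by auto
    qed
  qed
  finally show ?thesis by (simp add: r_def)
qed

section \<open>Rank of polynomial matrices over the rational functions\<close>

lemma common_denominator:
  fixes S :: "'a::idom fract set"
  assumes "finite S"
  shows "\<exists>d. d \<noteq> 0 \<and> (\<forall>x\<in>S. \<exists>a. to_fract d * x = to_fract a)"
  using assms
proof (induction S)
  case empty
  show ?case by (auto intro: exI[of _ 1])
next
  case (insert x S)
  then obtain d where d: "d \<noteq> 0" "\<forall>y\<in>S. \<exists>a. to_fract d * y = to_fract a" by blast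
  obtain a b where x: "x = Fraction_Field.Fract a b" "b \<noteq> 0" by (cases x) auto
  then have x': "to_fract b * x = to_fract a" by (simp add: to_fract_def eq_fract)
  have "\<exists>a. to_fract (b * d) * y = to_fract a" if "y \<in> insert x S" for y
  proof (cases "y = x")
    case True
    have "to_fract (b * d) * x = to_fract d * (to_fract b * x)" by (simp add: ac_simps)
    then have "to_fract (b * d) * y = to_fract (d * a)" unfolding True x' by simp
    then show ?thesis ..
  next
    case False
    then obtain c where "to_fract d * y = to_fract c" using d(2) \<open>y \<in> insert x S\<close> by blast
    then have "to_fract (b * d) * y = to_fract (b * c)" by (simp add: mult.assoc)
    then show ?thesis ..
  qed
  moreover have "b * d \<noteq> 0" using x(2) d(1) by simp
  ultimately show ?case by blast
qed

text \<open>
  Both matrices are scaled by the same \<open>d\<close>, so that linear relations between them survive.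
\<close>

lemma mat_common_denominator:
  fixes L N :: "'a::idom fract mat"
  obtains d L' N' where "d \<noteq> 0" "L' \<in> carrier_mat (dim_row L) (dim_col L)"
    "N' \<in> carrier_mat (dim_row N) (dim_col N)"
    "map_mat to_fract L' = to_fract d \<cdot>\<^sub>m L" "map_mat to_fract N' = to_fract d \<cdot>\<^sub>m N"
proof -
  obtain d where d: "d \<noteq> 0" "\<forall>x \<in> elements_mat L \<union> elements_mat N. \<exists>a. to_fract d * x = to_fract a"
    using common_denominator[of "elements_mat L \<union> elements_mat N"]
    by (auto simp: elements_mat_def)
  then obtain f where f: "\<And>x. x \<in> elements_mat L \<union> elements_mat N \<Longrightarrow> to_fract d * x = to_fract (f x)"
    by metis
  have "map_mat to_fract (map_mat f L) = to_fract d \<cdot>\<^sub>m L"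
    by (rule eq_matI) (auto simp: f[OF UnI1[OF elements_matI[OF carrier_matI[OF refl refl]]]])
  moreover have "map_mat to_fract (map_mat f N) = to_fract d \<cdot>\<^sub>m N"
    by (rule eq_matI) (auto simp: f[OF UnI2[OF elements_matI[OF carrier_matI[OF refl refl]]]])
  ultimately show thesis using that[of d "map_mat f L" "map_mat f N"] d(1) by auto
qed

text \<open>
  Clearing denominators: a relation over the fraction field is a scalar multiple of a relation over
  the domain. From here on all rank conditions can be handled as statements about polynomial
  matrices.
\<close>

lemma rows_indpt_mod_to_fract_iff:
  fixes X Y :: "'a::idom mat"
  assumes X: "X \<in> carrier_mat g n" and Y: "Y \<in> carrier_mat k n"
  shows "rows_indpt_mod (map_mat to_fract X) (map_mat to_fract Y) \<longleftrightarrow> rows_indpt_mod X Y"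
proof -
  let ?h = "to_fract :: 'a \<Rightarrow> 'a fract"
  interpret h: inj_comm_ring_hom ?h by unfold_locales auto
  have hX: "map_mat ?h X \<in> carrier_mat g n" and hY: "map_mat ?h Y \<in> carrier_mat k n" using X Y by auto
  show ?thesis
  proof
    assume mod: "rows_indpt_mod (map_mat ?h X) (map_mat ?h Y)"
    show "rows_indpt_mod X Y"
      unfolding rows_indpt_mod_def
    proof (intro allI ballI impI)
      fix j L N assume L': "L \<in> carrier_mat j (dim_row X)" and N': "N \<in> carrier_mat j (dim_row Y)" and eq: "L * X = N * Y"
      have L: "L \<in> carrier_mat j g" and N: "N \<in> carrier_mat j k" using L' N' X Y by auto
      have "map_mat ?h L * map_mat ?h X = map_mat ?h N * map_mat ?h Y"
        using eq by (simp add: h.mat_hom_mult[OF L X, symmetric] h.mat_hom_mult[OF N Y, symmetric])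
      then have "map_mat ?h N = 0\<^sub>m j k"
        using rows_indpt_modD[OF mod hX hY, of "map_mat ?h L" j "map_mat ?h N"] L N by auto
      then show "N = 0\<^sub>m j (dim_row Y)"
      proof -
        have "map_mat ?h (0\<^sub>m j k) = 0\<^sub>m j k" by (intro eq_matI) auto
        with \<open>map_mat ?h N = 0\<^sub>m j k\<close> have "N = 0\<^sub>m j k" by (intro h.mat_hom_inj) simp
        then show ?thesis using Y by simp
      qed
    qed
  next
    assume mod: "rows_indpt_mod X Y"
    show "rows_indpt_mod (map_mat ?h X) (map_mat ?h Y)"
      unfolding rows_indpt_mod_def
    proof (intro allI ballI impI)
      fix j L N assume "L \<in> carrier_mat j (dim_row (map_mat ?h X))" "N \<in> carrier_mat j (dim_row (map_mat ?h Y))"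
        and eq: "L * map_mat ?h X = N * map_mat ?h Y"
      then have L: "L \<in> carrier_mat j g" and N: "N \<in> carrier_mat j k" using X Y by auto
      obtain d L' N' where d: "d \<noteq> 0" and L': "L' \<in> carrier_mat j g" and N': "N' \<in> carrier_mat j k"
        and hL: "map_mat ?h L' = ?h d \<cdot>\<^sub>m L" and hN: "map_mat ?h N' = ?h d \<cdot>\<^sub>m N"
        using mat_common_denominator[of L N] L N by auto
      have "map_mat ?h (L' * X) = ?h d \<cdot>\<^sub>m (L * map_mat ?h X)"
        using mult_smult_assoc_mat[OF L hX] by (simp add: h.mat_hom_mult[OF L' X] hL)
      also have "\<dots> = map_mat ?h (N' * Y)"
        using mult_smult_assoc_mat[OF N hY] by (simp add: h.mat_hom_mult[OF N' Y] hN eq)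
      finally have "L' * X = N' * Y" by (rule h.mat_hom_inj)
      then have N'0: "N' = 0\<^sub>m j k" by (rule rows_indpt_modD[OF mod X Y L' N'])
      have "?h d * N $$ (a, b) = 0" if "a < j" "b < k" for a b
        using arg_cong[OF hN, of "\<lambda>A. A $$ (a, b)"] that N by (simp add: N'0)
      then have "N $$ (a, b) = 0" if "a < j" "b < k" for a b
        using that d by fastforce
      then show "N = 0\<^sub>m j (dim_row (map_mat ?h Y))"
        using N Y by (intro eq_matI) auto
    qed
  qed
qed

lemma full_row_rank_iff:
  assumes C: "C \<in> carrier_mat k c"
  shows "full_row_rank C \<longleftrightarrow> rows_indpt C"
proof -
  have hC: "map_mat to_fract C \<in> carrier_mat k c" using C by simp
  have "full_row_rank C \<longleftrightarrow> rows_indpt (map_mat to_fract C)"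
    using rows_indpt_iff_rank[OF hC] C by (simp add: full_row_rank_def poly_rank_def)
  also have "\<dots> \<longleftrightarrow> rows_indpt_mod (map_mat to_fract (0\<^sub>m 0 c)) (map_mat to_fract C)"
  proof -
    have "map_mat to_fract (0\<^sub>m 0 c :: real poly mat) = 0\<^sub>m 0 c" by (intro eq_matI) auto
    then show ?thesis using rows_indpt_iff_mod_empty[OF hC] by simp
  qed
  also have "\<dots> \<longleftrightarrow> rows_indpt C"
    using rows_indpt_mod_to_fract_iff[OF zero_carrier_mat C] rows_indpt_iff_mod_empty[OF C] by simp
  finally show ?thesis .
qed

lemma append_rows_index:
  assumes "A \<in> carrier_mat g n" "B \<in> carrier_mat k n" "i < g + k" "j < n"
  shows "(A @\<^sub>r B) $$ (i, j) = (if i < g then A $$ (i, j) else B $$ (i - g, j))"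
  using assms by (simp add: append_rows_def)

lemma poly_rank_append_rows_iff:
  assumes X: "X \<in> carrier_mat g n" and Y: "Y \<in> carrier_mat k n"
  shows "poly_rank (X @\<^sub>r Y) = poly_rank X + k \<longleftrightarrow> rows_indpt_mod X Y"
proof -
  have hX: "map_mat to_fract X \<in> carrier_mat g n" and hY: "map_mat to_fract Y \<in> carrier_mat k n"
    using X Y by auto
  have XY: "X @\<^sub>r Y \<in> carrier_mat (g + k) n" using X Y by simp
  have "map_mat to_fract (X @\<^sub>r Y) = map_mat to_fract X @\<^sub>r map_mat to_fract Y"
    unfolding append_rows_def by (rule eq_matI) (use X Y in auto)
  then show ?thesis
    using rank_append_rows_iff[OF hX hY] rows_indpt_mod_to_fract_iff[OF X Y] X XY
    by (simp add: poly_rank_def)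
qed

text \<open>
  A relation between the rows of \<open>[R M]\<close> and \<open>[0 C]\<close> splits into its two column blocks.
\<close>

lemma block_rank_iff:
  assumes R: "R \<in> carrier_mat g w" and M: "M \<in> carrier_mat g c" and C: "C \<in> carrier_mat k c"
  shows "poly_rank (four_block_mat R M (0\<^sub>m k w) C) = poly_rank (R @\<^sub>c M) + k \<longleftrightarrow>
    (\<forall>j. \<forall>L \<in> carrier_mat j g. \<forall>N \<in> carrier_mat j k. L * R = 0\<^sub>m j w \<and> L * M = N * C \<longrightarrow> N = 0\<^sub>m j k)"
proof -
  have X: "R @\<^sub>c M \<in> carrier_mat g (w + c)" and Y: "0\<^sub>m k w @\<^sub>c C \<in> carrier_mat k (w + c)"
    using R M C by auto
  have "four_block_mat R M (0\<^sub>m k w) C = (R @\<^sub>c M) @\<^sub>r (0\<^sub>m k w @\<^sub>c C)"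
    unfolding append_rows_def by (rule eq_matI) (use R M C in auto)
  moreover have "L * (R @\<^sub>c M) = N * (0\<^sub>m k w @\<^sub>c C) \<longleftrightarrow> L * R = 0\<^sub>m j w \<and> L * M = N * C"
    if L: "L \<in> carrier_mat j g" and N: "N \<in> carrier_mat j k" for j L N
  proof -
    have "L * R \<in> carrier_mat j w" "L * M \<in> carrier_mat j c" "N * C \<in> carrier_mat j c"
      using L N R M C by auto
    moreover have "N * 0\<^sub>m k w = 0\<^sub>m j w" using N by simp
    ultimately show ?thesis
      using append_cols_eq_iff[of "L * R" j w "0\<^sub>m j w" "L * M" c "N * C"]
      by (simp only: mult_append_cols[OF L R M] mult_append_cols[OF N zero_carrier_mat C]) simp
  qed
  ultimately show ?thesis
    using poly_rank_append_rows_iff[OF X Y] R C by (auto simp: rows_indpt_mod_def)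
qed

section \<open>Regular controllers in terms of the control manifest behavior\<close>

lemma ker_diff_carrier_iff:
  assumes "A \<in> carrier_mat g q"
  shows "x \<in> ker_diff A \<longleftrightarrow> x \<in> smooth_traj q \<and> (\<forall>i<g. mat_act A (component x) i = 0)"
  using assms by (simp add: ker_diff_iff)

lemma full_plant_iff:
  assumes R: "R \<in> carrier_mat g w" and M: "M \<in> carrier_mat g c"
  shows "(x, y) \<in> full_plant R M \<longleftrightarrow> x \<in> smooth_traj w \<and> y \<in> smooth_traj c \<and>
    (\<forall>i<g. mat_act R (component x) i + mat_act M (component y) i = 0)"
proof -
  have "(\<forall>t. mat_diff R x t + mat_diff M y t = 0\<^sub>v g) \<longleftrightarrow>
      (\<forall>i<g. mat_act R (component x) i + mat_act M (component y) i = 0)"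
    if "x \<in> smooth_traj w" "y \<in> smooth_traj c"
  proof -
    have "(\<forall>t. mat_diff R x t + mat_diff M y t = 0\<^sub>v g) \<longleftrightarrow>
        (\<forall>t. \<forall>i<g. fun_of (mat_act R (component x) i + mat_act M (component y) i) t = 0)"
      using R M that by (simp add: mat_diff_eq vec_eq_iff plus_smooth.rep_eq)
    also have "\<dots> \<longleftrightarrow> (\<forall>i<g. mat_act R (component x) i + mat_act M (component y) i = 0)"
      by (auto simp: zero_smooth.rep_eq simp flip: fun_of_inject)
    finally show ?thesis .
  qed
  then show ?thesis using R M by (auto simp: full_plant_def)
qed

lemma sum_lessThan_add:
  fixes f :: "nat \<Rightarrow> 'a::comm_monoid_add"
  shows "(\<Sum>j<w + c. f j) = (\<Sum>j<w. f j) + (\<Sum>j<c. f (w + j))"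
  by (induction c) (simp_all add: add.assoc)

lemma mat_act_append_cols:
  assumes A: "A \<in> carrier_mat g w" and B: "B \<in> carrier_mat g c" and i: "i < g"
  shows "mat_act (A @\<^sub>c B) X i = mat_act A X i + mat_act B (\<lambda>j. X (w + j)) i"
proof -
  have "mat_act (A @\<^sub>c B) X i = (\<Sum>j<w + c. (A @\<^sub>c B) $$ (i, j) \<bullet>\<^sub>D X j)"
    using A B by (simp add: mat_act_def)
  also have "\<dots> = (\<Sum>j<w. (A @\<^sub>c B) $$ (i, j) \<bullet>\<^sub>D X j) + (\<Sum>j<c. (A @\<^sub>c B) $$ (i, w + j) \<bullet>\<^sub>D X (w + j))"
    by (rule sum_lessThan_add)
  also have "\<dots> = mat_act A X i + mat_act B (\<lambda>j. X (w + j)) i"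
    using A B i by (simp add: mat_act_def)
  finally show ?thesis .
qed

lemma mat_act_zero_mat: "i < g \<Longrightarrow> mat_act (0\<^sub>m g w) X i = 0"
  by (simp add: mat_act_def)

text \<open>
  The equations \<open>Pc c = 0\<close> hold for every \<open>(w, c)\<close> in the plant, so the rows of \<open>[0 Pc]\<close> lie in
  the row module of \<open>[R M]\<close>.
\<close>

lemma manifest_rows_from_plant:
  assumes R: "R \<in> carrier_mat g w" and M: "M \<in> carrier_mat g c" and Pc: "Pc \<in> carrier_mat p c"
    and manifest: "control_manifest (full_plant R M) = ker_diff Pc"
  obtains F where "F \<in> carrier_mat p g" "F * R = 0\<^sub>m p w" "F * M = Pc"
proof -
  have RM: "R @\<^sub>c M \<in> carrier_mat g (w + c)" and Pc': "0\<^sub>m p w @\<^sub>c Pc \<in> carrier_mat p (w + c)"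
    using R M Pc by auto
  have "ker_diff (R @\<^sub>c M) \<subseteq> ker_diff (0\<^sub>m p w @\<^sub>c Pc)"
  proof
    fix x assume x: "x \<in> ker_diff (R @\<^sub>c M)"
    define X where "X = component x"
    define u y where "u = traj_of w X" and "y = traj_of c (\<lambda>j. X (w + j))"
    have act: "mat_act A (component u) = mat_act A X" if "A \<in> carrier_mat h w" for A h
      using that by (intro mat_act_cong) (simp add: u_def component_traj_of)
    have act': "mat_act B (component y) = mat_act B (\<lambda>j. X (w + j))" if "B \<in> carrier_mat h c" for B h
      using that by (intro mat_act_cong) (simp add: y_def component_traj_of)
    have "mat_act R X i + mat_act M (\<lambda>j. X (w + j)) i = 0" if "i < g" for i
      using x that by (simp add: ker_diff_carrier_iff[OF RM] mat_act_append_cols[OF R M] X_def)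
    then have "(u, y) \<in> full_plant R M"
      unfolding full_plant_iff[OF R M] using act[OF R] act'[OF M]
      by (simp add: u_def y_def traj_of_smooth)
    then have "y \<in> ker_diff Pc"
      using manifest unfolding control_manifest_def by blast
    then have "mat_act (0\<^sub>m p w @\<^sub>c Pc) X i = 0" if "i < p" for i
      using that act'[OF Pc] mat_act_append_cols[OF zero_carrier_mat Pc that, of w X]
      by (simp add: ker_diff_carrier_iff[OF Pc] mat_act_zero_mat)
    then show "x \<in> ker_diff (0\<^sub>m p w @\<^sub>c Pc)"
      using x unfolding ker_diff_carrier_iff[OF RM] ker_diff_carrier_iff[OF Pc'] X_def by blast
  qed
  then obtain F where F: "F \<in> carrier_mat p g" and eq: "0\<^sub>m p w @\<^sub>c Pc = F * (R @\<^sub>c M)"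
    by (rule ker_diff_subset_imp_left_multiple[OF RM Pc'])
  have "F * R \<in> carrier_mat p w" "F * M \<in> carrier_mat p c" using F R M by auto
  then have "0\<^sub>m p w = F * R \<and> Pc = F * M"
    using eq append_cols_eq_iff[of "0\<^sub>m p w" p w "F * R" Pc c "F * M"] Pc
    by (simp only: mult_append_cols[OF F R M]) simp
  with F show thesis using that by simp
qed

text \<open>
  Conversely, a combination of plant equations in which \<open>w\<close> is eliminated holds on the control
  manifest behavior, and is therefore a consequence of \<open>Pc c = 0\<close>.
\<close>

lemma annihilated_plant_rows_in_manifest:
  assumes R: "R \<in> carrier_mat g w" and M: "M \<in> carrier_mat g c" and Pc: "Pc \<in> carrier_mat p c"
    and manifest: "control_manifest (full_plant R M) = ker_diff Pc"
    and L: "L \<in> carrier_mat j g" and LR: "L * R = 0\<^sub>m j w"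
  obtains V where "V \<in> carrier_mat j p" "L * M = V * Pc"
proof (rule ker_diff_subset_imp_left_multiple[OF Pc])
  show LM: "L * M \<in> carrier_mat j c" using L M by simp
  show "ker_diff Pc \<subseteq> ker_diff (L * M)"
  proof
    fix y assume "y \<in> ker_diff Pc"
    then obtain x where "(x, y) \<in> full_plant R M"
      using manifest unfolding control_manifest_def by blast
    then have y: "y \<in> smooth_traj c"
      and plant: "\<And>i. i < g \<Longrightarrow> mat_act R (component x) i + mat_act M (component y) i = 0"
      by (simp_all add: full_plant_iff[OF R M])
    have "mat_act (L * M) (component y) i = 0" if i: "i < j" for i
    proof -
      have "mat_act (L * R) (component x) i + mat_act (L * M) (component y) i
          = mat_act L (mat_act R (component x)) i + mat_act L (mat_act M (component y)) i"
        using L R M i by (simp add: mat_act_mult)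
      also have "\<dots> = mat_act L (\<lambda>i. mat_act R (component x) i + mat_act M (component y) i) i"
        by (simp add: mat_act_def act_add_right sum.distrib)
      also have "\<dots> = 0"
        by (rule mat_act_zero) (use plant L in simp)
      finally show ?thesis
        using i by (simp add: LR mat_act_zero_mat)
    qed
    with y show "y \<in> ker_diff (L * M)" by (simp add: ker_diff_carrier_iff[OF LM])
  qed
qed (use that in blast)

text \<open>
  By the two preceding lemmas the rows \<open>L M\<close> with \<open>L R = 0\<close> are exactly the combinations of the rows
  of \<open>Pc\<close>; regularity thus means that the controller adds equations that are independent of those
  already imposed on \<open>c\<close> by the plant.
\<close>

proposition regular_block_rank_iff:
  assumes R: "R \<in> carrier_mat g w" and M: "M \<in> carrier_mat g c" and Pc: "Pc \<in> carrier_mat p c"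
    and manifest: "control_manifest (full_plant R M) = ker_diff Pc"
    and C: "C \<in> carrier_mat k c"
  shows "poly_rank (four_block_mat R M (0\<^sub>m k w) C) = poly_rank (R @\<^sub>c M) + k \<longleftrightarrow> rows_indpt_mod Pc C"
  unfolding block_rank_iff[OF R M C]
proof
  obtain F where F: "F \<in> carrier_mat p g" "F * R = 0\<^sub>m p w" "F * M = Pc"
    using manifest_rows_from_plant[OF R M Pc manifest] by blast
  assume indpt: "\<forall>j. \<forall>L\<in>carrier_mat j g. \<forall>N\<in>carrier_mat j k. L * R = 0\<^sub>m j w \<and> L * M = N * C \<longrightarrow> N = 0\<^sub>m j k"
  show "rows_indpt_mod Pc C"
    unfolding rows_indpt_mod_def
  proof (intro allI ballI impI)
    fix j V N assume V': "V \<in> carrier_mat j (dim_row Pc)" and N': "N \<in> carrier_mat j (dim_row C)" and eq: "V * Pc = N * C"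
    have V: "V \<in> carrier_mat j p" and N: "N \<in> carrier_mat j k" using V' N' Pc C by auto
    have "V * F \<in> carrier_mat j g" using V F by simp
    moreover have "(V * F) * R = 0\<^sub>m j w" using V F by (simp add: assoc_mult_mat[OF V F(1) R])
    moreover have "(V * F) * M = N * C" using eq by (simp only: assoc_mult_mat[OF V F(1) M] F(3))
    ultimately show "N = 0\<^sub>m j (dim_row C)" using indpt N C by blast
  qed
next
  assume mod: "rows_indpt_mod Pc C"
  show "\<forall>j. \<forall>L\<in>carrier_mat j g. \<forall>N\<in>carrier_mat j k. L * R = 0\<^sub>m j w \<and> L * M = N * C \<longrightarrow> N = 0\<^sub>m j k"
  proof (intro allI ballI impI)
    fix j L N assume L: "L \<in> carrier_mat j g" and N: "N \<in> carrier_mat j k"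
      and eq: "L * R = 0\<^sub>m j w \<and> L * M = N * C"
    then obtain V where "V \<in> carrier_mat j p" "L * M = V * Pc"
      using annihilated_plant_rows_in_manifest[OF R M Pc manifest L] by blast
    with eq show "N = 0\<^sub>m j k" using rows_indpt_modD[OF mod Pc C _ N] by simp
  qed
qed

lemma regular_controller_iff:
  assumes R: "R \<in> carrier_mat g w" and M: "M \<in> carrier_mat g c" and Pc: "Pc \<in> carrier_mat p c"
    and manifest: "control_manifest (full_plant R M) = ker_diff Pc"
  shows "regular_controller R M K \<longleftrightarrow>
    (\<exists>k. \<exists>C \<in> carrier_mat k c. rows_indpt_mod Pc C \<and> K = ker_diff C)"
proof -
  have "full_row_rank C \<and> K = ker_diff C \<and>
        poly_rank (four_block_mat R M (0\<^sub>m k w) C) = poly_rank (R @\<^sub>c M) + poly_rank C \<longleftrightarrow>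
      rows_indpt_mod Pc C \<and> K = ker_diff C" if C: "C \<in> carrier_mat k c" for k C
    using regular_block_rank_iff[OF R M Pc manifest C] full_row_rank_iff[OF C] C
      rows_indpt_mod_imp_rows_indpt[OF _ Pc C]
    by (auto simp: full_row_rank_def)
  then show ?thesis
    unfolding regular_controller_def using R M by auto
qed

section \<open>Parametrization of the controllers\<close>

lemma ker_diff_append_rows:
  assumes A: "A \<in> carrier_mat g q" and B: "B \<in> carrier_mat h q"
  shows "ker_diff (A @\<^sub>r B) = ker_diff A \<inter> ker_diff B"
proof -
  have AB: "A @\<^sub>r B \<in> carrier_mat (g + h) q" using A B by simp
  have "(\<forall>i<g + h. mat_act (A @\<^sub>r B) X i = 0) \<longleftrightarrow>
      (\<forall>i<g. mat_act A X i = 0) \<and> (\<forall>i<h. mat_act B X i = 0)" for X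
  proof -
    have "mat_act (A @\<^sub>r B) X i = mat_act A X i" if "i < g" for i
      using that A B carrier_matD(2)[OF AB] by (simp add: mat_act_def append_rows_index[OF A B])
    moreover have "mat_act (A @\<^sub>r B) X (g + i) = mat_act B X i" if "i < h" for i
      using that A B carrier_matD(2)[OF AB] by (simp add: mat_act_def append_rows_index[OF A B])
    moreover have "(\<forall>i<g + h. Q i) \<longleftrightarrow> (\<forall>i<g. Q i) \<and> (\<forall>i<h. Q (g + i))" for Q
    proof (intro iffI allI impI)
      fix i assume Q: "(\<forall>i<g. Q i) \<and> (\<forall>i<h. Q (g + i))" and "i < g + h"
      show "Q i"
      proof (cases "i < g")
        case False
        then have "i = g + (i - g)" "i - g < h" using \<open>i < g + h\<close> by auto
        with Q show ?thesis by metis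
      qed (use Q in blast)
    qed auto
    ultimately show ?thesis by simp
  qed
  then show ?thesis
    by (auto simp: set_eq_iff ker_diff_carrier_iff[OF A] ker_diff_carrier_iff[OF B] ker_diff_carrier_iff[OF AB])
qed

text \<open>
  The intersection is the kernel of the stacked matrix, whose row module consists of the sums
  of combinations of \<open>A\<close> and of \<open>B\<close>.
\<close>

lemma common_kernel_imp_combination:
  assumes A: "A \<in> carrier_mat g q" and B: "B \<in> carrier_mat h q" and C: "C \<in> carrier_mat k q"
    and sub: "ker_diff A \<inter> ker_diff B \<subseteq> ker_diff C"
  obtains X Y where "X \<in> carrier_mat k g" "Y \<in> carrier_mat k h" "C = X * A + Y * B"
proof -
  have AB: "A @\<^sub>r B \<in> carrier_mat (g + h) q" using A B by simp
  obtain L where L: "L \<in> carrier_mat k (g + h)" "C = L * (A @\<^sub>r B)"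
    using ker_diff_subset_imp_left_multiple[OF AB C] sub ker_diff_append_rows[OF A B] by metis
  from L(1) obtain X Y where "X \<in> carrier_mat k g" "Y \<in> carrier_mat k h" "L = X @\<^sub>c Y"
    by (rule split_cols)
  with that L(2) append_cols_mult_append_rows[OF _ _ A B] show thesis by metis
qed

lemma ker_diff_add_multiple:
  assumes A: "A \<in> carrier_mat p q" and C: "C \<in> carrier_mat k q" and V: "V \<in> carrier_mat k p"
  shows "ker_diff A \<inter> ker_diff C \<subseteq> ker_diff (V * A + C)"
proof
  fix x assume x: "x \<in> ker_diff A \<inter> ker_diff C"
  have VA: "V * A \<in> carrier_mat k q" and sum: "V * A + C \<in> carrier_mat k q" using A C V by auto
  have "x \<in> ker_diff (V * A)" using x ker_diff_mult[of V A] A V by auto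
  moreover have "mat_act (V * A + C) X i = mat_act (V * A) X i + mat_act C X i" if "i < k" for X i
    using that VA A C by (simp add: mat_act_def act_add_left sum.distrib del: index_mult_mat(1))
  ultimately show "x \<in> ker_diff (V * A + C)"
    using x by (simp add: ker_diff_carrier_iff[OF VA] ker_diff_carrier_iff[OF C] ker_diff_carrier_iff[OF sum])
qed

lemma mat_add_cancel:
  fixes P Q U :: "'a::ab_group_add mat"
  assumes "P \<in> carrier_mat k q" "Q \<in> carrier_mat k q" "U \<in> carrier_mat k q"
  shows "- P + (P + Q) = Q" and "P + Q - P = Q" and "P + (Q + U) - U = P + Q"
  using assms by (auto intro!: eq_matI)

lemma mat_diff_eq_zeroD:
  fixes P Q :: "'a::ab_group_add mat"
  assumes "P \<in> carrier_mat k q" "Q \<in> carrier_mat k q" and zero: "P - Q = 0\<^sub>m k q"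
  shows "P = Q"
proof (rule eq_matI)
  fix i j assume "i < dim_row Q" "j < dim_col Q"
  then show "P $$ (i, j) = Q $$ (i, j)"
    using arg_cong[OF zero, of "\<lambda>U. U $$ (i, j)"] assms(1,2) by simp
qed (use assms(1,2) in auto)

lemma uminus_mult_add_cancel:
  fixes V :: "'a::comm_ring_1 mat"
  assumes A: "A \<in> carrier_mat p q" and C: "C \<in> carrier_mat k q" and V: "V \<in> carrier_mat k p"
  shows "- V * A + (V * A + C) = C"
proof -
  have "- V * A = - (V * A)" using A V by simp
  moreover have "V * A \<in> carrier_mat k q" using A V by simp
  ultimately show ?thesis
    using C by (simp only: mat_add_cancel(1))
qed

lemma rows_indpt_mod_add_multiple:
  assumes mod: "rows_indpt_mod A C"
    and A: "A \<in> carrier_mat p q" and C: "C \<in> carrier_mat k q" and V: "V \<in> carrier_mat k p"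
  shows "rows_indpt_mod A (V * A + C)"
  unfolding rows_indpt_mod_def
proof (intro allI ballI impI)
  fix j L N assume L': "L \<in> carrier_mat j (dim_row A)" and N': "N \<in> carrier_mat j (dim_row (V * A + C))"
    and eq: "L * A = N * (V * A + C)"
  have L: "L \<in> carrier_mat j p" and N: "N \<in> carrier_mat j k" using L' N' A C by auto
  have VA: "V * A \<in> carrier_mat k q" and NV: "N * V \<in> carrier_mat j p" using A V N by auto
  have NVA: "N * V * A \<in> carrier_mat j q" and NC: "N * C \<in> carrier_mat j q" using NV A N C by auto
  have "(L - N * V) * A = L * A - N * V * A"
    by (rule minus_mult_distrib_mat[OF L NV A])
  also have "L * A = N * V * A + N * C"
    by (simp only: eq mult_add_distrib_mat[OF N VA C] assoc_mult_mat[OF N V A])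
  also have "N * V * A + N * C - N * V * A = N * C"
    by (rule mat_add_cancel(2)[OF NVA NC NC])
  finally have "(L - N * V) * A = N * C" .
  moreover have "L - N * V \<in> carrier_mat j p" using NV by (rule minus_carrier_mat)
  ultimately show "N = 0\<^sub>m j (dim_row (V * A + C))"
    using rows_indpt_modD[OF mod A C _ N] C by simp
qed

text \<open>
  Regularity does not depend on the representation of the controller, as long as its rows are
  independent.
\<close>

lemma rows_indpt_mod_same_kernel:
  assumes A: "A \<in> carrier_mat p q" and C: "C \<in> carrier_mat k q" and C0: "C0 \<in> carrier_mat k0 q"
    and mod: "rows_indpt_mod A C0" and indpt: "rows_indpt C" and ker: "ker_diff C0 = ker_diff C"
  shows "rows_indpt_mod A C"
  unfolding rows_indpt_mod_def
proof (intro allI ballI impI)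
  obtain Y where Y: "Y \<in> carrier_mat k k0" and CY: "C = Y * C0"
    using ker_diff_subset_imp_left_multiple[OF C0 C] ker by blast
  fix j L N assume L': "L \<in> carrier_mat j (dim_row A)" and N': "N \<in> carrier_mat j (dim_row C)" and eq: "L * A = N * C"
  have L: "L \<in> carrier_mat j p" and N: "N \<in> carrier_mat j k" using L' N' A C by auto
  have NC: "N * C = (N * Y) * C0" unfolding CY by (rule assoc_mult_mat[OF N Y C0, symmetric])
  have NY: "N * Y \<in> carrier_mat j k0" using N Y by simp
  have "N * Y = 0\<^sub>m j k0"
    using rows_indpt_modD[OF mod A C0 L NY] eq NC by simp
  then have "N * C = 0\<^sub>m j q" using NC C0 by simp
  then show "N = 0\<^sub>m j (dim_row C)"
    using rows_indptD[OF indpt C N] C by simp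
qed

text \<open>
  Equality of the intersections gives \<open>C' = X A + Y C\<close> and \<open>C = X' A + Y' C'\<close>. Substituting the second
  into the first and using independence of \<open>C'\<close> modulo \<open>A\<close> gives \<open>Y Y' = 1\<close>. Hence
  \<open>Y' C' = C - X' A\<close> has the same kernel as \<open>C'\<close>, so \<open>V = - X'\<close> works.
\<close>

lemma ker_diff_parametrization:
  assumes A: "A \<in> carrier_mat p q" and C: "C \<in> carrier_mat k q" and C': "C' \<in> carrier_mat k' q"
    and mod: "rows_indpt_mod A C'"
    and same: "ker_diff C' \<inter> ker_diff A = ker_diff C \<inter> ker_diff A"
  shows "\<exists>V \<in> carrier_mat k p. ker_diff C' = ker_diff (V * A + C)"
proof -
  obtain X Y where X: "X \<in> carrier_mat k' p" and Y: "Y \<in> carrier_mat k' k" and eq': "C' = X * A + Y * C"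
    using common_kernel_imp_combination[OF A C C'] same by blast
  obtain X' Y' where X': "X' \<in> carrier_mat k p" and Y': "Y' \<in> carrier_mat k k'" and eq: "C = X' * A + Y' * C'"
    using common_kernel_imp_combination[OF A C' C] same by blast
  have YX': "Y * X' \<in> carrier_mat k' p" and YY': "Y * Y' \<in> carrier_mat k' k'"
    and XA: "X * A \<in> carrier_mat k' q" and X'A: "X' * A \<in> carrier_mat k q" and Y'C': "Y' * C' \<in> carrier_mat k q"
    using X Y X' Y' A C' by auto
  have YX'A: "Y * X' * A \<in> carrier_mat k' q" and YY'C': "Y * Y' * C' \<in> carrier_mat k' q"
    using YX' YY' A C' by auto
  have C'_eq: "C' = X * A + (Y * X' * A + Y * Y' * C')"
    using eq' by (simp only: eq mult_add_distrib_mat[OF Y X'A Y'C'] assoc_mult_mat[OF Y X' A] assoc_mult_mat[OF Y Y' C'])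
  have "(X + Y * X') * A = X * A + Y * X' * A"
    by (rule add_mult_distrib_mat[OF X YX' A])
  also have "\<dots> = C' - Y * Y' * C'"
    using mat_add_cancel(3)[OF XA YX'A YY'C'] by (simp only: C'_eq[symmetric])
  also have "\<dots> = (1\<^sub>m k' - Y * Y') * C'"
    using minus_mult_distrib_mat[OF one_carrier_mat YY' C'] C' by simp
  finally have comb: "(X + Y * X') * A = (1\<^sub>m k' - Y * Y') * C'" .
  have zero: "1\<^sub>m k' - Y * Y' = 0\<^sub>m k' k'"
    by (rule rows_indpt_modD[OF mod A C' _ minus_carrier_mat[OF YY'] comb]) (use X YX' in simp)
  have "Y * Y' = 1\<^sub>m k'"
    by (rule mat_diff_eq_zeroD[OF one_carrier_mat YY' zero, symmetric])
  then have C'_Y: "C' = Y * (Y' * C')"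
    using C' by (simp flip: assoc_mult_mat[OF Y Y' C'])
  have "ker_diff C' = ker_diff (Y' * C')"
    using ker_diff_mult[of Y' C'] ker_diff_mult[of Y "Y' * C'"] Y Y' C' by (auto simp flip: C'_Y)
  moreover have "- X' * A + C = Y' * C'"
    unfolding eq by (rule uminus_mult_add_cancel[OF A Y'C' X'])
  ultimately show ?thesis using X' by (metis uminus_carrier_mat)
qed

theorem theorem11:
  fixes g w c p k :: nat
    and R M Pc C :: "real poly mat"
    and S K K' :: "traj set"
  assumes "R \<in> carrier_mat g w" and "M \<in> carrier_mat g c"
    and "behavior w S"
    and "Pc \<in> carrier_mat p c" and "full_row_rank Pc"
    and "control_manifest (full_plant R M) = ker_diff Pc"
    and "K \<in> can_reg R M S"
    and "C \<in> carrier_mat k c" and "full_row_rank C"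
    and "K = ker_diff C"
    and "behavior c K'"
  shows "K' \<in> can_reg R M S \<longleftrightarrow> (\<exists>V \<in> carrier_mat k p. K' = ker_diff (V * Pc + C))"
proof -
  note Pc = assms(4) and C = assms(8)
  note regular_iff = regular_controller_iff[OF assms(1,2,4,6)]
  have K: "regular_controller R M (ker_diff C)"
    "ker_diff C \<inter> ker_diff Pc = canonical_controller (full_plant R M) S \<inter> ker_diff Pc"
    using assms(7) unfolding can_reg_def assms(6) assms(10) by simp_all
  have can_reg_iff: "B \<in> can_reg R M S \<longleftrightarrow>
      regular_controller R M B \<and> B \<inter> ker_diff Pc = ker_diff C \<inter> ker_diff Pc" for B
    unfolding can_reg_def assms(6) K(2) by simp
  obtain k0 C0 where "C0 \<in> carrier_mat k0 c" "rows_indpt_mod Pc C0" "ker_diff C0 = ker_diff C"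
    using K(1) unfolding regular_iff by metis
  then have mod: "rows_indpt_mod Pc C"
    using rows_indpt_mod_same_kernel[OF Pc C] assms(9) full_row_rank_iff[OF C] by simp
  show ?thesis
  proof
    assume "K' \<in> can_reg R M S"
    then have reg: "regular_controller R M K'" and same: "K' \<inter> ker_diff Pc = ker_diff C \<inter> ker_diff Pc"
      by (simp_all add: can_reg_iff)
    from reg obtain k' C' where C': "C' \<in> carrier_mat k' c" and mod': "rows_indpt_mod Pc C'"
      and K': "K' = ker_diff C'"
      unfolding regular_iff by metis
    show "\<exists>V \<in> carrier_mat k p. K' = ker_diff (V * Pc + C)"
      using ker_diff_parametrization[OF Pc C C' mod'] same unfolding K' by simp
  next
    assume "\<exists>V \<in> carrier_mat k p. K' = ker_diff (V * Pc + C)"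
    then obtain V where V: "V \<in> carrier_mat k p" and K': "K' = ker_diff (V * Pc + C)" by blast
    have C': "V * Pc + C \<in> carrier_mat k c" using C by simp
    have "ker_diff Pc \<inter> ker_diff C \<subseteq> ker_diff (V * Pc + C)"
      by (rule ker_diff_add_multiple[OF Pc C V])
    moreover have "ker_diff Pc \<inter> ker_diff (V * Pc + C) \<subseteq> ker_diff C"
      using ker_diff_add_multiple[OF Pc C', of "- V"] V
      by (simp add: uminus_mult_add_cancel[OF Pc C V])
    ultimately have "K' \<inter> ker_diff Pc = ker_diff C \<inter> ker_diff Pc"
      unfolding K' by blast
    moreover have "regular_controller R M K'"
      unfolding regular_iff using C' rows_indpt_mod_add_multiple[OF mod Pc C V] K' by metis
    ultimately show "K' \<in> can_reg R M S"
      by (simp add: can_reg_iff)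
  qed
qed

end
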